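(* Let $C_{\phi,w}$ be a bounded operator defined on the whole of $L^2(\mu)$ such that $E_{\phi,w}(h_{\phi,w})=h_{\phi,w}$ a.e. $[\mu_w]$ and $h_{\phi,w}\circ\phi\leq h_{\phi,w}$ a.e. $[\mu_w]$. Then $C_{\phi,w}$ has a nontrivial invariant subspace.
   Context: $(X,\mathscr A,\mu)$ is a $\sigma$-finite measure space, $\phi\colon X\to X$ and $w\colon X\to\mathbb C$ are $\mathscr A$-measurable, $\mu_w(\sigma)=\int_\sigma|w|^2\,d\mu$ for $\sigma\in\mathscr A$, and the measure $\mu_w\circ\phi^{-1}$, $\sigma\mapsto\mu_w(\phi^{-1}(\sigma))$, is assumed absolutely continuous with respect to $\mu$. The weighted composition operator $C_{\phi,w}$ in the complex Hilbert space $L^2(\mu)$ has domain $\{f\in L^2(\mu): w\cdot(f\circ\phi)\in L^2(\mu)\}$ and acts by $C_{\phi,w}f=w\cdot(f\circ\phi)$. The function $h_{\phi,w}\colon X\to[0,\infty]$ is the Radon-Nikodym derivative, i.e. the (up to $\mu$-null sets) unique $\mathscr A$-measurable function with $\mu_w(\phi^{-1}(\Delta))=\int_\Delta h_{\phi,w}\,d\mu$ for all $\Delta\in\mathscr A$. $E_{\phi,w}(f)$ denotes the conditional expectation of an $\mathscr A$-measurable $f\colon X\to[0,\infty]$ with respect to the $\sigma$-algebra $\phi^{-1}(\mathscr A)$ and the measure $\mu_w$: the (up to $\mu_w$-null sets) unique $\phi^{-1}(\mathscr A)$-measurable function with $\int_\Delta f\,d\mu_w=\int_\Delta E_{\phi,w}(f)\,d\mu_w$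 for all $\Delta\in\phi^{-1}(\mathscr A)$. A closed subspace $\mathcal M$ of a Hilbert space $\mathcal H$ is invariant for a bounded operator $T$ on $\mathcal H$ if $T\mathcal M\subseteq\mathcal M$; it is nontrivial if $\mathcal M\neq\{0\}$ and $\mathcal M\neq\mathcal H$.
   Formalization: The formal theorem additionally assumes that L²(μ) has dimension at least 2 (contains two linearly independent vectors); in dimension 0 or 1 no nontrivial subspace exists, so the claim fails there. *)

theory Defs
  imports "HOL-Probability.Probability"
begin

text \<open>
  The Hilbert space \<open>L\<^sup>2(\<mu>)\<close> is represented by its square-integrable measurable functions;
  two of them denote the same vector iff they agree almost everywhere.
\<close>

definition L2_fun :: "'a measure \<Rightarrow> ('a \<Rightarrow> complex) set" where
  "L2_fun M = {f \<in> borel_measurable M. integrable M (\<lambda>x. (cmod (f x))\<^sup>2)}"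

definition L2_seminorm :: "'a measure \<Rightarrow> ('a \<Rightarrow> complex) \<Rightarrow> real" where
  "L2_seminorm M f = sqrt (\<integral>x. (cmod (f x))\<^sup>2 \<partial>M)"

text \<open>
  The last clause says that the subspace contains all its adherent points; with \<open>L2_seminorm M (f - g) = 0\<close>
  it also makes the set of representatives stable under almost everywhere equality, so that these
  sets correspond exactly to the closed subspaces of the space of equivalence classes.
\<close>

definition L2_closed_subspace :: "'a measure \<Rightarrow> ('a \<Rightarrow> complex) set \<Rightarrow> bool" where
  "L2_closed_subspace M S \<longleftrightarrow>
     S \<subseteq> L2_fun M \<and>
     (\<lambda>_. 0) \<in> S \<and>
     (\<forall>f\<in>S. \<forall>g\<in>S. (\<lambda>x. f x + g x) \<in> S) \<and>
     (\<forall>c. \<forall>f\<in>S. (\<lambda>x. c * f x) \<in> S) \<and>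
     (\<forall>f\<in>L2_fun M. (\<forall>e>0. \<exists>g\<in>S. L2_seminorm M (\<lambda>x. f x - g x) < e) \<longrightarrow> f \<in> S)"

definition L2_nontrivial :: "'a measure \<Rightarrow> ('a \<Rightarrow> complex) set \<Rightarrow> bool" where
  "L2_nontrivial M S \<longleftrightarrow> (\<exists>f\<in>S. \<not> (AE x in M. f x = 0)) \<and> S \<noteq> L2_fun M"

definition L2_has_nontrivial_invariant_subspace ::
    "'a measure \<Rightarrow> (('a \<Rightarrow> complex) \<Rightarrow> ('a \<Rightarrow> complex)) \<Rightarrow> bool" where
  "L2_has_nontrivial_invariant_subspace M T \<longleftrightarrow>
     (\<exists>S. L2_closed_subspace M S \<and> L2_nontrivial M S \<and> T ` S \<subseteq> S)"

definition L2_linearly_independent ::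
    "'a measure \<Rightarrow> ('a \<Rightarrow> complex) \<Rightarrow> ('a \<Rightarrow> complex) \<Rightarrow> bool" where
  "L2_linearly_independent M f g \<longleftrightarrow>
     (\<forall>a b. (AE x in M. a * f x + b * g x = 0) \<longrightarrow> a = 0 \<and> b = 0)"

definition weighted_measure :: "'a measure \<Rightarrow> ('a \<Rightarrow> complex) \<Rightarrow> 'a measure" where
  "weighted_measure M w = density M (\<lambda>x. ennreal ((cmod (w x))\<^sup>2))"

definition wcomp :: "('a \<Rightarrow> 'a) \<Rightarrow> ('a \<Rightarrow> complex) \<Rightarrow> ('a \<Rightarrow> complex) \<Rightarrow> ('a \<Rightarrow> complex)" where
  "wcomp \<phi> w f = (\<lambda>x. w x * f (\<phi> x))"

definition wcomp_domain :: "'a measure \<Rightarrow> ('a \<Rightarrow> 'a) \<Rightarrow> ('a \<Rightarrow> complex) \<Rightarrow> ('a \<Rightarrow> complex) set" where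
  "wcomp_domain M \<phi> w = {f \<in> L2_fun M. wcomp \<phi> w f \<in> L2_fun M}"

definition wcomp_bounded :: "'a measure \<Rightarrow> ('a \<Rightarrow> 'a) \<Rightarrow> ('a \<Rightarrow> complex) \<Rightarrow> bool" where
  "wcomp_bounded M \<phi> w \<longleftrightarrow>
     (\<exists>C. \<forall>f\<in>wcomp_domain M \<phi> w. L2_seminorm M (wcomp \<phi> w f) \<le> C * L2_seminorm M f)"

definition wcomp_h :: "'a measure \<Rightarrow> ('a \<Rightarrow> 'a) \<Rightarrow> ('a \<Rightarrow> complex) \<Rightarrow> 'a \<Rightarrow> ennreal" where
  "wcomp_h M \<phi> w = RN_deriv M (distr (weighted_measure M w) M \<phi>)"

text \<open>
  The \<open>\<sigma>\<close>-algebra \<open>\<phi>\<^sup>-\<^sup>1(\<A>)\<close> is \<^term>\<open>vimage_algebra (space M) \<phi> M\<close>. When the operator is bounded,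
  \<^const>\<open>wcomp_h\<close> is finite almost everywhere, hence the weighted measure is \<open>\<sigma>\<close>-finite
  on this subalgebra and \<^const>\<open>nn_cond_exp\<close> is the usual conditional expectation.
\<close>

definition wcomp_cond_exp ::
    "'a measure \<Rightarrow> ('a \<Rightarrow> 'a) \<Rightarrow> ('a \<Rightarrow> complex) \<Rightarrow> ('a \<Rightarrow> ennreal) \<Rightarrow> 'a \<Rightarrow> ennreal" where
  "wcomp_cond_exp M \<phi> w f = nn_cond_exp (weighted_measure M w) (vimage_algebra (space M) \<phi> M) f"

end

theory Submission
  imports Defs "HOL-Library.Function_Algebras"
begin

text \<open>
  Let \<open>h\<close> be the Radon--Nikodym derivative that belongs to the weighted composition operator
  \<open>C\<close>. Two facts carry the proof: \<open>C\<^sup>* C\<close> is multiplication by \<open>h\<close> (\<open>wcomp_nn_integral\<close>), and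
  \<open>h \<circ> \<phi> \<le> h\<close> says that \<open>C\<close> moves supports towards larger values of \<open>h\<close>.

  Suppose first that \<open>h\<close> is not almost everywhere constant. Then some threshold \<open>c\<close> splits the space
  into two sets \<open>{h < c}\<close> and \<open>{c \<le> h}\<close> of positive measure, and the functions supported on
  \<open>{c \<le> h}\<close> form a closed subspace that \<open>C\<close> maps into itself (\<open>wcomp_superlevel_invariant\<close>).

  If \<open>h\<close> is constant, this constant is finite and \<open>C\<close> is a multiple of an isometry. What is then
  needed is that an isometry \<open>T\<close> of a complex Hilbert space of dimension at least two has a
  nontrivial invariant subspace (\<open>isometric_op_has_nontrivial_invariant\<close>). If the range is not
  dense, its closure is such a subspace. Otherwise \<open>T\<close> is unitary. Instead of the spectral
  theorem the proof uses only a square root: for a unit \<open>c\<close> let \<open>B\<close> be the self-adjoint part of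
  \<open>c T\<close> and let \<open>R = \<bar>B\<bar>\<close> be the square root of \<open>B\<^sup>2\<close>, the limit of an explicit sequence of polynomials
  in \<open>B\<^sup>2\<close>. From \<open>(R - B) (R + B) = 0\<close> one gets that the kernel of \<open>R - B\<close> is a nontrivial
  invariant subspace unless \<open>B = R\<close> or \<open>B = - R\<close>, that is, unless \<open>B\<close> is definite
  (\<open>invariant_or_definite\<close>). When \<open>B\<close> is definite for every \<open>c\<close>, the numerical range of \<open>T\<close> lies
  on one ray, and an isometry with this property is a scalar, for which every closed subspace is
  invariant.

  Square-integrable functions are not identified when they agree almost everywhere. The Hilbert
  space part is therefore developed for positive semidefinite forms, with equality of vectors
  replaced by distance zero.
\<close>

section \<open>Positive semidefinite forms\<close>

lemma nonneg_quadratic_discrim: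
  fixes a b r :: real
  assumes quad: "\<And>t. 0 \<le> a + 2 * t * r + t\<^sup>2 * b" and "0 \<le> b"
  shows "r\<^sup>2 \<le> a * b"
proof (cases "b = 0")
  case True
  have "r = 0"
  proof (rule ccontr)
    assume "r \<noteq> 0"
    then have "a + 2 * (- (a + 1) / (2 * r)) * r = -1" by (simp add: field_simps)
    with quad[of "- (a + 1) / (2 * r)"] True show False by simp
  qed
  then show ?thesis using True by simp
next
  case False
  have "a + 2 * (- r / b) * r + (- r / b)\<^sup>2 * b = a - r\<^sup>2 / b"
    using False by (simp add: power2_eq_square)
  with quad[of "- r / b"] have "r\<^sup>2 / b \<le> a" by simp
  moreover have "0 < b" using False assms(2) by simp
  ultimately show ?thesis by (simp only: pos_divide_le_eq)
qed

text \<open>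
  Vectors of \<open>L\<^sup>2\<close> are represented by functions, so distinct vectors may have distance zero. The
  abstract setting is therefore a vector space with a positive semidefinite form on a subspace
  \<open>H\<close>. Addition and scaling are those of the surrounding space and obey exact identities, whereas
  identities derived from the form, such as those for an inverse of an isometry, hold only up to
  vectors of norm zero.
\<close>

locale semi_inner_product = vector_space scale
  for scale :: "complex \<Rightarrow> 'v::ab_group_add \<Rightarrow> 'v" (infixr \<open>*\<^sub>C\<close> 75) +
  fixes H :: "'v set" and ip :: "'v \<Rightarrow> 'v \<Rightarrow> complex"
  assumes subspace_H: "subspace H"
    and ip_add_left: "\<lbrakk>x \<in> H; y \<in> H; z \<in> H\<rbrakk> \<Longrightarrow> ip (x + y) z = ip x z + ip y z"
    and ip_scale_left: "\<lbrakk>x \<in> H; y \<in> H\<rbrakk> \<Longrightarrow> ip (c *\<^sub>C x) y = c * ip x y"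
    and ip_commute: "\<lbrakk>x \<in> H; y \<in> H\<rbrakk> \<Longrightarrow> ip y x = cnj (ip x y)"
    and ip_nonneg: "x \<in> H \<Longrightarrow> 0 \<le> Re (ip x x)"
begin

abbreviation linear_op :: "('v \<Rightarrow> 'v) \<Rightarrow> bool" where
  "linear_op T \<equiv> Vector_Spaces.linear (*\<^sub>C) (*\<^sub>C) T"

lemma linear_op_iff:
  "linear_op T \<longleftrightarrow> (\<forall>x y. T (x + y) = T x + T y) \<and> (\<forall>c x. T (c *\<^sub>C x) = c *\<^sub>C T x)"
  unfolding Vector_Spaces.linear_def module_hom_iff
  using vector_space_axioms module_axioms by auto

lemma linear_op_add: "linear_op T \<Longrightarrow> T (x + y) = T x + T y"
  and linear_op_scale: "linear_op T \<Longrightarrow> T (c *\<^sub>C x) = c *\<^sub>C T x"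
  by (auto simp: linear_op_iff)

lemma linear_op_diff: "linear_op T \<Longrightarrow> T (x - y) = T x - T y"
  using linear_op_add[of T "x - y" y] by (simp add: algebra_simps)

lemma H_zero [simp]: "0 \<in> H"
  and H_add [simp]: "\<lbrakk>x \<in> H; y \<in> H\<rbrakk> \<Longrightarrow> x + y \<in> H"
  and H_diff [simp]: "\<lbrakk>x \<in> H; y \<in> H\<rbrakk> \<Longrightarrow> x - y \<in> H"
  and H_scale [simp]: "x \<in> H \<Longrightarrow> c *\<^sub>C x \<in> H"
  using subspace_H by (auto intro: subspace_0 subspace_add subspace_diff subspace_scale)

lemma ip_add_right: "\<lbrakk>x \<in> H; y \<in> H; z \<in> H\<rbrakk> \<Longrightarrow> ip z (x + y) = ip z x + ip z y"
  by (metis H_add complex_cnj_add ip_add_left ip_commute)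

lemma ip_scale_right: "\<lbrakk>x \<in> H; y \<in> H\<rbrakk> \<Longrightarrow> ip y (c *\<^sub>C x) = cnj c * ip y x"
  by (metis H_scale complex_cnj_mult ip_scale_left ip_commute)

lemma ip_diff_left: "\<lbrakk>x \<in> H; y \<in> H; z \<in> H\<rbrakk> \<Longrightarrow> ip (x - y) z = ip x z - ip y z"
  by (metis H_diff add_diff_cancel diff_add_cancel ip_add_left)

lemma ip_diff_right: "\<lbrakk>x \<in> H; y \<in> H; z \<in> H\<rbrakk> \<Longrightarrow> ip z (x - y) = ip z x - ip z y"
  by (metis H_diff add_diff_cancel diff_add_cancel ip_add_right)

lemmas ip_simps = ip_add_left ip_add_right ip_scale_left ip_scale_right ip_diff_left ip_diff_right

lemma Im_ip_self [simp]: "x \<in> H \<Longrightarrow> Im (ip x x) = 0"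
  using ip_commute[of x x] by (simp add: complex_eq_iff)

definition nrm :: "'v \<Rightarrow> real" where
  "nrm x = sqrt (Re (ip x x))"

lemma nrm_nonneg [simp]: "x \<in> H \<Longrightarrow> 0 \<le> nrm x"
  by (simp add: nrm_def ip_nonneg)

lemma nrm_squared: "x \<in> H \<Longrightarrow> (nrm x)\<^sup>2 = Re (ip x x)"
  by (simp add: nrm_def ip_nonneg)

lemma ip_self: "x \<in> H \<Longrightarrow> ip x x = of_real ((nrm x)\<^sup>2)"
  by (simp add: complex_eq_iff nrm_squared)

lemma Re_ip_commute: "\<lbrakk>x \<in> H; y \<in> H\<rbrakk> \<Longrightarrow> Re (ip y x) = Re (ip x y)"
  by (subst ip_commute) auto

lemma nrm_scale: "x \<in> H \<Longrightarrow> nrm (c *\<^sub>C x) = cmod c * nrm x"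
proof -
  assume x: "x \<in> H"
  have "ip (c *\<^sub>C x) (c *\<^sub>C x) = (c * cnj c) * ip x x"
    using x by (simp add: ip_simps)
  also have "c * cnj c = of_real ((cmod c)\<^sup>2)"
    by (rule complex_norm_square[symmetric])
  finally have "Re (ip (c *\<^sub>C x) (c *\<^sub>C x)) = (cmod c)\<^sup>2 * Re (ip x x)"
    by (simp del: of_real_power)
  then show ?thesis
    by (simp add: nrm_def real_sqrt_mult)
qed

lemma nrm_minus_commute: "\<lbrakk>x \<in> H; y \<in> H\<rbrakk> \<Longrightarrow> nrm (x - y) = nrm (y - x)"
  by (simp add: nrm_def ip_simps)

lemma nrm_add_squared:
  assumes "x \<in> H" "y \<in> H"
  shows "(nrm (x + y))\<^sup>2 = (nrm x)\<^sup>2 + 2 * Re (ip x y) + (nrm y)\<^sup>2"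
proof -
  have "ip (x + y) (x + y) = ip x x + ip x y + (ip y x + ip y y)"
    using assms by (simp add: ip_add_left ip_add_right)
  then show ?thesis
    using assms Re_ip_commute[OF assms] by (simp add: nrm_squared)
qed

lemma Re_Cauchy_Schwarz:
  assumes "x \<in> H" "y \<in> H"
  shows "Re (ip x y) \<le> nrm x * nrm y"
proof -
  have quad: "0 \<le> (nrm x)\<^sup>2 + 2 * t * Re (ip x y) + t\<^sup>2 * (nrm y)\<^sup>2" for t :: real
  proof -
    define z where "z = of_real t *\<^sub>C y"
    have z: "z \<in> H" using assms by (simp add: z_def)
    have "Re (ip x z) = t * Re (ip x y)" "nrm z = \<bar>t\<bar> * nrm y"
      using assms by (simp_all add: z_def ip_scale_right nrm_scale)
    then show ?thesis
      using nrm_add_squared[of x z] zero_le_power2[of "nrm (x + z)"] assms z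
      by (simp add: power_mult_distrib)
  qed
  have "(Re (ip x y))\<^sup>2 \<le> (nrm x)\<^sup>2 * (nrm y)\<^sup>2"
    using quad by (rule nonneg_quadratic_discrim) simp
  then show ?thesis
    using assms by - (rule power2_le_imp_le; simp add: power_mult_distrib)
qed

lemma Cauchy_Schwarz:
  assumes "x \<in> H" "y \<in> H"
  shows "cmod (ip x y) \<le> nrm x * nrm y"
proof (cases "ip x y = 0")
  case False
  define c where "c = cnj (ip x y) / of_real (cmod (ip x y))"
  have "ip (c *\<^sub>C x) y = of_real (cmod (ip x y))"
  proof -
    have "ip (c *\<^sub>C x) y = (ip x y * cnj (ip x y)) / of_real (cmod (ip x y))"
      using assms by (simp add: c_def ip_simps)
    also have "ip x y * cnj (ip x y) = of_real ((cmod (ip x y))\<^sup>2)"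
      by (rule complex_norm_square[symmetric])
    also have "\<dots> / of_real (cmod (ip x y)) = of_real (cmod (ip x y))"
      using False by (simp add: power2_eq_square)
    finally show ?thesis .
  qed
  moreover have "cmod c = 1"
    using False by (simp add: c_def norm_divide)
  ultimately show ?thesis
    using Re_Cauchy_Schwarz[of "c *\<^sub>C x" y] assms by (simp add: nrm_scale)
qed (use assms in simp)

lemma nrm_triangle: 
  assumes "x \<in> H" "y \<in> H"
  shows "nrm (x + y) \<le> nrm x + nrm y"
proof -
  have "(nrm (x + y))\<^sup>2 = (nrm x)\<^sup>2 + 2 * Re (ip x y) + (nrm y)\<^sup>2"
    using assms by (rule nrm_add_squared)
  also have "\<dots> \<le> (nrm x + nrm y)\<^sup>2"
    using Re_Cauchy_Schwarz[OF assms] by (simp add: power2_sum)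
  finally show ?thesis
    using assms by - (rule power2_le_imp_le; simp)
qed

lemma nrm_triangle_diff:
  assumes "x \<in> H" "y \<in> H" "z \<in> H"
  shows "nrm (x - z) \<le> nrm (x - y) + nrm (y - z)"
  using nrm_triangle[of "x - y" "y - z"] assms by simp

lemma nrm_zero [simp]: "nrm 0 = 0"
  using nrm_scale[of 0 0] by simp

lemma nrm_diff_le: "\<lbrakk>x \<in> H; y \<in> H\<rbrakk> \<Longrightarrow> nrm (x - y) \<le> nrm x + nrm y"
  using nrm_triangle_diff[of x 0 y] nrm_minus_commute[of 0 y] by simp

lemma nrm_eq_if_close:
  assumes "x \<in> H" "y \<in> H" "nrm (x - y) = 0"
  shows "nrm x = nrm y"
  using nrm_triangle[of "x - y" y] nrm_triangle[of "y - x" x] nrm_minus_commute[of x y] assms by simp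

lemma nrm_add_null:
  assumes "nrm x = 0" "nrm y = 0" "x \<in> H" "y \<in> H"
  shows "nrm (x + y) = 0"
proof (rule antisym)
  show "nrm (x + y) \<le> 0" using nrm_triangle[of x y] assms by simp
  show "0 \<le> nrm (x + y)" using assms by simp
qed

lemma ip_null:
  assumes "x \<in> H" "y \<in> H" "nrm x = 0"
  shows "ip x y = 0" "ip y x = 0"
  using Cauchy_Schwarz[of x y] Cauchy_Schwarz[of y x] assms by simp_all

lemma ip_eq_if_close:
  assumes "x \<in> H" "x' \<in> H" "y \<in> H" "nrm (x - x') = 0"
  shows "ip x y = ip x' y" "ip y x = ip y x'"
  using ip_null[of "x - x'" y] assms by (simp_all add: ip_simps)

definition closed_subspace :: "'v set \<Rightarrow> bool" where
  "closed_subspace S \<longleftrightarrow> S \<subseteq> H \<and> subspace S \<and>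
     (\<forall>x\<in>H. (\<forall>e>0. \<exists>y\<in>S. nrm (x - y) < e) \<longrightarrow> x \<in> S)"

definition nontrivial_invariant :: "('v \<Rightarrow> 'v) \<Rightarrow> 'v set \<Rightarrow> bool" where
  "nontrivial_invariant T S \<longleftrightarrow> closed_subspace S \<and> (\<exists>x\<in>S. nrm x \<noteq> 0) \<and> S \<noteq> H \<and> T ` S \<subseteq> S"

definition isometric_op :: "('v \<Rightarrow> 'v) \<Rightarrow> bool" where
  "isometric_op T \<longleftrightarrow> linear_op T \<and> (\<forall>x\<in>H. T x \<in> H \<and> nrm (T x) = nrm x)"

lemma isometric_op_in: "\<lbrakk>isometric_op T; x \<in> H\<rbrakk> \<Longrightarrow> T x \<in> H"
  and isometric_op_nrm: "\<lbrakk>isometric_op T; x \<in> H\<rbrakk> \<Longrightarrow> nrm (T x) = nrm x"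
  and isometric_op_linear: "isometric_op T \<Longrightarrow> linear_op T"
  by (auto simp: isometric_op_def)

lemma isometric_op_dist:
  "\<lbrakk>isometric_op T; x \<in> H; y \<in> H\<rbrakk> \<Longrightarrow> nrm (T x - T y) = nrm (x - y)"
  by (simp add: isometric_op_nrm flip: linear_op_diff[OF isometric_op_linear])

text \<open>
  Polarization: the norm determines the real part of the form, and replacing \<open>y\<close> by
  \<open>\<i> y\<close> gives the imaginary part.
\<close>

lemma isometric_op_ip:
  assumes T: "isometric_op T" and xy: "x \<in> H" "y \<in> H"
  shows "ip (T x) (T y) = ip x y"
proof -
  note [simp] = isometric_op_in[OF T] isometric_op_nrm[OF T]
  have re: "Re (ip (T u) (T v)) = Re (ip u v)" if "u \<in> H" "v \<in> H" for u v
  proof -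
    have "nrm (T u + T v) = nrm (u + v)"
      using T that by (simp flip: linear_op_add[OF isometric_op_linear[OF T]])
    then have "(nrm (T u + T v))\<^sup>2 = (nrm (u + v))\<^sup>2" by simp
    then show ?thesis using T that by (simp add: nrm_add_squared)
  qed
  have "Im (ip (T x) (T y)) = Re (ip (T x) (T (\<i> *\<^sub>C y)))"
    using T xy by (simp add: linear_op_scale[OF isometric_op_linear[OF T]] ip_simps)
  also have "\<dots> = Im (ip x y)"
    using re[of x "\<i> *\<^sub>C y"] xy by (simp add: ip_simps)
  finally show ?thesis
    using re[OF xy] by (simp add: complex_eq_iff)
qed

lemma closure_range_closed:
  assumes T: "isometric_op T"
  shows "closed_subspace {x \<in> H. \<forall>e>0. \<exists>y\<in>H. nrm (x - T y) < e}" (is "closed_subspace ?S")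
  unfolding closed_subspace_def
proof (intro conjI ballI impI)
  note lin = isometric_op_linear[OF T] and [simp] = isometric_op_in[OF T] isometric_op_nrm[OF T]
  show "subspace ?S"
  proof (rule subspaceI)
    show "0 \<in> ?S"
      using linear_op_scale[OF lin, of 0 0] by (auto intro!: bexI[of _ 0])
  next
    fix x y assume xy: "x \<in> ?S" "y \<in> ?S"
    have "\<exists>z\<in>H. nrm (x + y - T z) < e" if e: "e > 0" for e
    proof -
      obtain a b where ab: "a \<in> H" "nrm (x - T a) < e/2" "b \<in> H" "nrm (y - T b) < e/2"
      proof -
        from xy have "\<forall>e>0. \<exists>a\<in>H. nrm (x - T a) < e" "\<forall>e>0. \<exists>b\<in>H. nrm (y - T b) < e"
          by blast+
        then have "\<exists>a\<in>H. nrm (x - T a) < e/2" "\<exists>b\<in>H. nrm (y - T b) < e/2"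
          using half_gt_zero[OF e] by blast+
        then show thesis using that by auto
      qed
      have "nrm (x + y - T (a + b)) \<le> nrm (x - T a) + nrm (y - T b)"
        using nrm_triangle[of "x - T a" "y - T b"] ab xy T
        by (simp add: linear_op_add[OF lin] algebra_simps)
      then show ?thesis using ab by (intro bexI[of _ "a + b"]) auto
    qed
    then show "x + y \<in> ?S" using xy by auto
  next
    fix c x assume x: "x \<in> ?S"
    have "\<exists>z\<in>H. nrm (c *\<^sub>C x - T z) < e" if e: "e > 0" for e
    proof -
      have "e / (cmod c + 1) > 0" using e by (simp add: add_nonneg_pos)
      then obtain a where a: "a \<in> H" "nrm (x - T a) < e / (cmod c + 1)"
        using x by blast
      have "nrm (c *\<^sub>C x - T (c *\<^sub>C a)) = cmod c * nrm (x - T a)"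
        using nrm_scale[of "x - T a" c] a x T
        by (simp add: linear_op_scale[OF lin] scale_right_diff_distrib)
      also have "\<dots> \<le> (cmod c + 1) * nrm (x - T a)"
        using a x T by (intro mult_right_mono) auto
      also have "\<dots> < e"
        using a by (simp add: pos_less_divide_eq add_nonneg_pos mult.commute)
      finally show ?thesis using a by (intro bexI[of _ "c *\<^sub>C a"]) auto
    qed
    then show "c *\<^sub>C x \<in> ?S" using x by auto
  qed
next
  fix x assume x: "x \<in> H" and app: "\<forall>e>0. \<exists>y\<in>?S. nrm (x - y) < e"
  have "\<exists>z\<in>H. nrm (x - T z) < e" if e: "e > 0" for e
  proof -
    obtain y where y: "y \<in> ?S" "nrm (x - y) < e/2" using app e half_gt_zero by blast
    then obtain z where z: "z \<in> H" "nrm (y - T z) < e/2" using e half_gt_zero by blast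
    show ?thesis
      using nrm_triangle_diff[of x y "T z"] x y z isometric_op_in[OF T] by (intro bexI[of _ z]) auto
  qed
  then show "x \<in> ?S" using x by simp
qed auto

end

section \<open>Completeness and inverses of isometries\<close>

text \<open>
  Completeness in the form of convergence of absolutely convergent series, which is what the
  Riesz--Fischer argument yields directly.
\<close>

locale semi_hilbert = semi_inner_product +
  assumes complete: "\<lbrakk>\<And>n::nat. X n \<in> H; summable (\<lambda>n. nrm (X n))\<rbrakk>
    \<Longrightarrow> \<exists>x\<in>H. (\<lambda>n. nrm (x - (\<Sum>i<n. X i))) \<longlonglongrightarrow> 0"
begin

lemma complete_telescope:
  assumes X: "\<And>n. X n \<in> H" and e: "summable e" "\<And>n. nrm (X (Suc n) - X n) \<le> e n"
  shows "\<exists>x\<in>H. (\<lambda>n. nrm (x - X n)) \<longlonglongrightarrow> 0"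
proof -
  have "summable (\<lambda>n. nrm (X (Suc n) - X n))"
    by (rule summable_comparison_test[OF _ e(1)]) (use X e in auto)
  from complete[OF _ this] X obtain x
    where x: "x \<in> H" "(\<lambda>n. nrm (x - (\<Sum>i<n. X (Suc i) - X i))) \<longlonglongrightarrow> 0" by auto
  have "x - (\<Sum>i<n. X (Suc i) - X i) = (x + X 0) - X n" for n
    by (simp add: sum_lessThan_telescope)
  then have "(\<lambda>n. nrm ((x + X 0) - X n)) \<longlonglongrightarrow> 0" using x(2) by (simp only:)
  then show ?thesis using x X by (intro bexI[of _ "x + X 0"]) auto
qed

text \<open>
  An isometry pulls a Cauchy sequence of images back to a Cauchy sequence, so a dense range of a
  complete space is everything.
\<close>

lemma isometric_dense_range_onto:
  assumes T: "isometric_op T" and dense: "\<And>x e. \<lbrakk>x \<in> H; e > 0\<rbrakk> \<Longrightarrow> \<exists>y\<in>H. nrm (x - T y) < e"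
    and x: "x \<in> H"
  shows "\<exists>y\<in>H. nrm (x - T y) = 0"
proof -
  note lin = isometric_op_linear[OF T] and [simp] = isometric_op_in[OF T] isometric_op_nrm[OF T]
  have "\<exists>y\<in>H. nrm (x - T y) < (1/2) ^ n" for n :: nat
    using dense[OF x] by simp
  then obtain Y where Y: "\<And>n::nat. Y n \<in> H" "\<And>n. nrm (x - T (Y n)) < (1/2) ^ n" by metis
  have "nrm (Y (Suc n) - Y n) \<le> 2 * (1/2) ^ n" for n
  proof -
    have "nrm (Y (Suc n) - Y n) = nrm (T (Y (Suc n)) - T (Y n))"
      using T Y by (simp add: isometric_op_dist[OF T])
    also have "\<dots> \<le> nrm (T (Y (Suc n)) - x) + nrm (x - T (Y n))"
      using T Y x by (intro nrm_triangle_diff) auto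
    also have "\<dots> \<le> (1/2) ^ Suc n + (1/2) ^ n"
      using Y[of n] Y[of "Suc n"] nrm_minus_commute[of x "T (Y (Suc n))"] x T by simp
    also have "\<dots> \<le> 2 * (1/2) ^ n" by simp
    finally show ?thesis .
  qed
  moreover have "summable (\<lambda>n. 2 * (1/2::real) ^ n)"
    by (intro summable_mult summable_geometric) simp
  ultimately obtain y where y: "y \<in> H" "(\<lambda>n. nrm (y - Y n)) \<longlonglongrightarrow> 0"
    using complete_telescope[of Y] Y by blast
  have "nrm (x - T y) \<le> (1/2) ^ n + nrm (y - Y n)" for n
  proof -
    have "nrm (x - T y) \<le> nrm (x - T (Y n)) + nrm (T (Y n) - T y)"
      using T Y x y by (intro nrm_triangle_diff) auto
    also have "nrm (T (Y n) - T y) = nrm (y - Y n)"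
      using T Y y by (simp add: isometric_op_dist[OF T] nrm_minus_commute)
    finally show ?thesis using Y(2)[of n] by simp
  qed
  moreover have "(\<lambda>n. (1/2) ^ n + nrm (y - Y n)) \<longlonglongrightarrow> 0 + 0"
    by (intro tendsto_add y LIMSEQ_realpow_zero) auto
  ultimately have "nrm (x - T y) \<le> 0"
    by (intro LIMSEQ_le_const[where X = "\<lambda>n. (1/2) ^ n + nrm (y - Y n)"]) auto
  then show ?thesis using y T x by (intro bexI[of _ y] antisym) auto
qed

text \<open>
  Choosing preimages vector by vector gives an inverse that is linear only up to null vectors. Choosing
  them on a Hamel basis and extending linearly gives one that is exactly linear. Exact linearity
  of an operator is what makes the polynomials in it commute exactly.
\<close>

lemma linear_inverse_mod_null:
  assumes T: "isometric_op T" and onto: "\<And>x. x \<in> H \<Longrightarrow> \<exists>y\<in>H. nrm (x - T y) = 0"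
  obtains V where "isometric_op V" "\<And>x. x \<in> H \<Longrightarrow> nrm (T (V x) - x) = 0"
    "\<And>x. x \<in> H \<Longrightarrow> nrm (V (T x) - x) = 0"
proof -
  note lin = isometric_op_linear[OF T] and [simp] = isometric_op_in[OF T] isometric_op_nrm[OF T]
  obtain B where B: "B \<subseteq> H" "independent B" "H \<subseteq> span B"
    by (rule maximal_independent_subset)
  have spanB: "span B = H"
    using B span_minimal[OF _ subspace_H] by auto
  obtain v where v: "\<And>x. x \<in> H \<Longrightarrow> v x \<in> H" "\<And>x. x \<in> H \<Longrightarrow> nrm (x - T (v x)) = 0"
    using onto by metis
  interpret vp: vector_space_pair scale scale ..
  obtain V where V: "linear_op V" "\<And>x. x \<in> B \<Longrightarrow> V x = v x"
    using vp.linear_independent_extend[OF B(2), of v] by auto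
  let ?P = "{x \<in> H. V x \<in> H \<and> nrm (T (V x) - x) = 0}"
  have "span B \<subseteq> ?P"
  proof (rule span_minimal)
    show "B \<subseteq> ?P"
    proof
      fix x assume "x \<in> B"
      then have "x \<in> H" "V x = v x" using B V by auto
      then show "x \<in> ?P" using v[of x] T nrm_minus_commute[of "T (v x)" x] by simp
    qed
    show "subspace ?P"
    proof (rule subspaceI)
      show "0 \<in> ?P"
        using linear_op_scale[OF lin, of 0 0] linear_op_scale[OF V(1), of 0 0] by simp
    next
      fix x y assume xy: "x \<in> ?P" "y \<in> ?P"
      have eq: "T (V (x + y)) - (x + y) = (T (V x) - x) + (T (V y) - y)"
        by (simp add: linear_op_add[OF lin] linear_op_add[OF V(1)])
      have "nrm (T (V x) - x) = 0" "nrm (T (V y) - y) = 0" "T (V x) - x \<in> H" "T (V y) - y \<in> H"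
        using xy T by simp_all
      then have "nrm (T (V (x + y)) - (x + y)) = 0"
        unfolding eq by (intro nrm_add_null)
      then show "x + y \<in> ?P"
        using xy by (simp add: linear_op_add[OF V(1)])
    next
      fix c x assume x: "x \<in> ?P"
      have "T (V (c *\<^sub>C x)) - c *\<^sub>C x = c *\<^sub>C (T (V x) - x)"
        by (simp add: linear_op_scale[OF lin] linear_op_scale[OF V(1)] scale_right_diff_distrib)
      then show "c *\<^sub>C x \<in> ?P"
        using x T by (simp add: nrm_scale linear_op_scale[OF V(1)])
    qed
  qed
  then have P: "V x \<in> H" "nrm (T (V x) - x) = 0" if "x \<in> H" for x
    using that spanB by auto
  have nV: "nrm (V x) = nrm x" if "x \<in> H" for x
    using nrm_eq_if_close[of "T (V x)" x] P[OF that] that T by simp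
  have "nrm (V (T x) - x) = 0" if x: "x \<in> H" for x
  proof -
    have "nrm (V (T x) - x) = nrm (T (V (T x)) - T x)"
      using x T P by (simp add: isometric_op_dist[OF T])
    then show ?thesis using P[of "T x"] x T by simp
  qed
  moreover have "isometric_op V"
    using P(1) nV V(1) by (simp add: isometric_op_def)
  ultimately show thesis using that P(2) by blast
qed

end

section \<open>Bounded operators and kernels of strong limits\<close>

context semi_inner_product begin

definition bounded_op :: "real \<Rightarrow> ('v \<Rightarrow> 'v) \<Rightarrow> bool" where
  "bounded_op K A \<longleftrightarrow> linear_op A \<and> (\<forall>x\<in>H. A x \<in> H \<and> nrm (A x) \<le> K * nrm x)"

lemma bounded_op_linear: "bounded_op K A \<Longrightarrow> linear_op A"
  and bounded_op_in: "\<lbrakk>bounded_op K A; x \<in> H\<rbrakk> \<Longrightarrow> A x \<in> H"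
  and bounded_op_nrm: "\<lbrakk>bounded_op K A; x \<in> H\<rbrakk> \<Longrightarrow> nrm (A x) \<le> K * nrm x"
  by (auto simp: bounded_op_def)

lemma isometric_op_bounded: "isometric_op T \<Longrightarrow> bounded_op 1 T"
  by (simp add: bounded_op_def isometric_op_def)

lemma bounded_op_id: "bounded_op 1 (\<lambda>x. x)"
  by (simp add: bounded_op_def linear_op_iff)

lemma bounded_op_add:
  assumes "bounded_op K A" "bounded_op L C"
  shows "bounded_op (K + L) (\<lambda>x. A x + C x)"
  unfolding bounded_op_def linear_op_iff
proof (intro conjI ballI allI)
  fix x assume x: "x \<in> H"
  have H: "A x \<in> H" "C x \<in> H"
    using bounded_op_in[OF assms(1) x] bounded_op_in[OF assms(2) x] by simp_all
  then show "A x + C x \<in> H" by simp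
  show "nrm (A x + C x) \<le> (K + L) * nrm x"
    using nrm_triangle[OF H] bounded_op_nrm[OF assms(1) x] bounded_op_nrm[OF assms(2) x]
    by (simp add: distrib_right)
qed (simp_all add: linear_op_add[OF bounded_op_linear[OF assms(1)]] linear_op_add[OF bounded_op_linear[OF assms(2)]]
       linear_op_scale[OF bounded_op_linear[OF assms(1)]] linear_op_scale[OF bounded_op_linear[OF assms(2)]]
       scale_right_distrib)

lemma bounded_op_scale:
  assumes "bounded_op K A"
  shows "bounded_op (cmod c * K) (\<lambda>x. c *\<^sub>C A x)"
  unfolding bounded_op_def linear_op_iff
proof (intro conjI ballI allI)
  fix x assume x: "x \<in> H"
  have H: "A x \<in> H" by (rule bounded_op_in[OF assms x])
  then show "c *\<^sub>C A x \<in> H" by simp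
  show "nrm (c *\<^sub>C A x) \<le> cmod c * K * nrm x"
    using mult_left_mono[OF bounded_op_nrm[OF assms x], of "cmod c"] H
    by (simp add: nrm_scale mult.assoc)
qed (simp_all add: linear_op_add[OF bounded_op_linear[OF assms]] linear_op_scale[OF bounded_op_linear[OF assms]]
       scale_right_distrib mult.commute)

lemma bounded_op_diff:
  assumes "bounded_op K A" "bounded_op L C"
  shows "bounded_op (K + L) (\<lambda>x. A x - C x)"
  using bounded_op_add[OF assms(1) bounded_op_scale[OF assms(2), of "-1"]] by simp

lemma bounded_op_comp:
  assumes A: "bounded_op K A" and C: "bounded_op L C" and "0 \<le> K"
  shows "bounded_op (K * L) (\<lambda>x. A (C x))"
  unfolding bounded_op_def linear_op_iff
proof (intro conjI ballI allI)
  fix x assume x: "x \<in> H"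
  have Cx: "C x \<in> H" by (rule bounded_op_in[OF C x])
  then show "A (C x) \<in> H" by (rule bounded_op_in[OF A])
  have "nrm (A (C x)) \<le> K * nrm (C x)" by (rule bounded_op_nrm[OF A Cx])
  also have "\<dots> \<le> K * (L * nrm x)" using bounded_op_nrm[OF C x] \<open>0 \<le> K\<close> by (rule mult_left_mono)
  finally show "nrm (A (C x)) \<le> K * L * nrm x" by (simp add: mult.assoc)
qed (simp_all add: linear_op_add[OF bounded_op_linear[OF A]] linear_op_add[OF bounded_op_linear[OF C]]
       linear_op_scale[OF bounded_op_linear[OF A]] linear_op_scale[OF bounded_op_linear[OF C]])

text \<open>
  Commutation cannot be demanded exactly: an isometry and its inverse commute only up to null
  vectors.
\<close>

definition commute_mod_null :: "('v \<Rightarrow> 'v) \<Rightarrow> ('v \<Rightarrow> 'v) \<Rightarrow> bool" where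
  "commute_mod_null T A \<longleftrightarrow> (\<forall>x\<in>H. nrm (T (A x) - A (T x)) = 0)"

lemma bounded_op_null:
  assumes "bounded_op K A" "x \<in> H" "nrm x = 0"
  shows "nrm (A x) = 0"
proof (rule antisym)
  show "nrm (A x) \<le> 0" using bounded_op_nrm[OF assms(1,2)] assms(3) by simp
  show "0 \<le> nrm (A x)" using bounded_op_in[OF assms(1,2)] by simp
qed

lemma commute_mod_null_id: "commute_mod_null T (\<lambda>x. x)"
  by (simp add: commute_mod_null_def)

lemma commute_mod_null_add:
  assumes T: "bounded_op J T" and A: "bounded_op K A" "commute_mod_null T A"
    and C: "bounded_op L C" "commute_mod_null T C"
  shows "commute_mod_null T (\<lambda>x. A x + C x)"
  unfolding commute_mod_null_def
proof
  fix x assume x: "x \<in> H"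
  have "T (A x + C x) - (A (T x) + C (T x)) = (T (A x) - A (T x)) + (T (C x) - C (T x))"
    by (simp add: linear_op_add[OF bounded_op_linear[OF T]])
  moreover have "nrm \<dots> = 0"
    using x A(2) C(2) bounded_op_in[OF T] bounded_op_in[OF A(1)] bounded_op_in[OF C(1)]
    by (intro nrm_add_null) (auto simp: commute_mod_null_def)
  ultimately show "nrm (T (A x + C x) - (A (T x) + C (T x))) = 0" by (simp only:)
qed

lemma commute_mod_null_scale:
  assumes T: "bounded_op J T" and A: "bounded_op K A" "commute_mod_null T A"
  shows "commute_mod_null T (\<lambda>x. c *\<^sub>C A x)"
  unfolding commute_mod_null_def
proof
  fix x assume x: "x \<in> H"
  have "T (c *\<^sub>C A x) - c *\<^sub>C A (T x) = c *\<^sub>C (T (A x) - A (T x))"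
    by (simp add: linear_op_scale[OF bounded_op_linear[OF T]] scale_right_diff_distrib)
  moreover have "T (A x) - A (T x) \<in> H"
    using x bounded_op_in[OF T] bounded_op_in[OF A(1)] by simp
  ultimately show "nrm (T (c *\<^sub>C A x) - c *\<^sub>C A (T x)) = 0"
    using A(2) x by (simp add: nrm_scale commute_mod_null_def)
qed

lemma commute_mod_null_diff:
  assumes T: "bounded_op J T" and A: "bounded_op K A" "commute_mod_null T A"
    and C: "bounded_op L C" "commute_mod_null T C"
  shows "commute_mod_null T (\<lambda>x. A x - C x)"
  using commute_mod_null_add[OF T A bounded_op_scale[OF C(1)] commute_mod_null_scale[OF T C], of "-1"]
  by simp

lemma commute_mod_null_comp:
  assumes T: "bounded_op J T" and A: "bounded_op K A" "commute_mod_null T A"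
    and C: "bounded_op L C" "commute_mod_null T C"
  shows "commute_mod_null T (\<lambda>x. A (C x))"
  unfolding commute_mod_null_def
proof
  fix x assume x: "x \<in> H"
  have H: "C x \<in> H" "T x \<in> H" "C (T x) \<in> H" "T (C x) \<in> H"
    using x bounded_op_in[OF T] bounded_op_in[OF C(1)] by auto
  have "T (A (C x)) - A (C (T x)) = (T (A (C x)) - A (T (C x))) + A (T (C x) - C (T x))"
    by (simp add: linear_op_diff[OF bounded_op_linear[OF A(1)]])
  moreover have "nrm \<dots> = 0"
  proof (rule nrm_add_null)
    show "nrm (T (A (C x)) - A (T (C x))) = 0"
      using A(2) H(1) by (simp add: commute_mod_null_def)
    show "nrm (A (T (C x) - C (T x))) = 0"
      using bounded_op_null[OF A(1)] C(2) x H by (simp add: commute_mod_null_def)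
  qed (use H bounded_op_in[OF T] bounded_op_in[OF A(1)] in auto)
  ultimately show "nrm (T (A (C x)) - A (C (T x))) = 0" by (simp only:)
qed

text \<open>
  The uniform bound makes convergence to zero pass to adherent points. The set is the kernel of
  the strong limit of the \<open>A n\<close>, but this description needs no limit operator, which could only
  be linear up to null vectors.
\<close>

lemma null_limit_closed_subspace:
  assumes A: "\<And>n::nat. bounded_op K (A n)"
  shows "closed_subspace {x \<in> H. (\<lambda>n. nrm (A n x)) \<longlonglongrightarrow> 0}" (is "closed_subspace ?S")
  unfolding closed_subspace_def
proof (intro conjI ballI impI)
  note lin = bounded_op_linear[OF A]
  have inH: "A n x \<in> H" if "x \<in> H" for n x using A that by (rule bounded_op_in)
  show "subspace ?S"
  proof (rule subspaceI)
    show "0 \<in> ?S" using linear_op_scale[OF lin, of _ 0 0] by simp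
  next
    fix x y assume xy: "x \<in> ?S" "y \<in> ?S"
    have "(\<lambda>n. nrm (A n (x + y))) \<longlonglongrightarrow> 0"
    proof (rule tendsto_sandwich[where f = "\<lambda>_. 0" and h = "\<lambda>n. nrm (A n x) + nrm (A n y)"])
      show "(\<lambda>n. nrm (A n x) + nrm (A n y)) \<longlonglongrightarrow> 0"
        using xy by (auto intro: tendsto_add_zero)
    qed (use xy inH in \<open>auto simp: linear_op_add[OF lin] intro!: always_eventually nrm_triangle\<close>)
    then show "x + y \<in> ?S" using xy by simp
  next
    fix c x assume x: "x \<in> ?S"
    then have "(\<lambda>n. cmod c * nrm (A n x)) \<longlonglongrightarrow> 0"
      by (auto intro: tendsto_mult_right_zero)
    then show "c *\<^sub>C x \<in> ?S"
      using x inH by (simp add: linear_op_scale[OF lin] nrm_scale)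
  qed
  fix x assume x: "x \<in> H" and app: "\<forall>e>0. \<exists>y\<in>?S. nrm (x - y) < e"
  have "\<exists>N. \<forall>n\<ge>N. norm (nrm (A n x) - 0) < e" if e: "e > 0" for e
  proof -
    have "0 < e / (2 * (\<bar>K\<bar> + 1))" using e by simp
    then obtain y where y: "y \<in> ?S" "nrm (x - y) < e / (2 * (\<bar>K\<bar> + 1))" using app by blast
    have "(\<bar>K\<bar> + 1) * nrm (x - y) < e / 2"
      using y(2) by (simp add: field_simps)
    moreover have "nrm (A n (x - y)) \<le> (\<bar>K\<bar> + 1) * nrm (x - y)" for n
    proof -
      have "K * nrm (x - y) \<le> (\<bar>K\<bar> + 1) * nrm (x - y)"
        using x y by (intro mult_right_mono) auto
      then show ?thesis using bounded_op_nrm[OF A, of "x - y" n] x y by simp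
    qed
    ultimately have far: "nrm (A n (x - y)) < e / 2" for n
      using order_le_less_trans by blast
    have "\<forall>e>0. \<exists>N. \<forall>n\<ge>N. norm (nrm (A n y) - 0) < e"
      using y by (simp add: LIMSEQ_iff)
    then obtain N where N: "\<And>n. n \<ge> N \<Longrightarrow> nrm (A n y) < e / 2"
      using half_gt_zero[OF e] by fastforce
    have "nrm (A n x) < e" if "n \<ge> N" for n
      using nrm_triangle[of "A n (x - y)" "A n y"] far[of n] N[OF that] x y inH
      by (simp add: linear_op_diff[OF lin])
    then show ?thesis using x inH by auto
  qed
  then have "(\<lambda>n. nrm (A n x)) \<longlonglongrightarrow> 0" by (rule LIMSEQ_I)
  then show "x \<in> ?S" using x by simp
qed auto

lemma null_limit_invariant:
  assumes A: "\<And>n::nat. bounded_op K (A n)" and T: "isometric_op T"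
    and comm: "\<And>n. commute_mod_null T (A n)"
  shows "T ` {x \<in> H. (\<lambda>n. nrm (A n x)) \<longlonglongrightarrow> 0} \<subseteq> {x \<in> H. (\<lambda>n. nrm (A n x)) \<longlonglongrightarrow> 0}"
proof -
  have "nrm (A n (T x)) = nrm (A n x)" if "x \<in> H" for n x
    using nrm_eq_if_close[of "T (A n x)" "A n (T x)"] comm that bounded_op_in[OF A]
      isometric_op_in[OF T] isometric_op_nrm[OF T]
    by (simp add: commute_mod_null_def)
  then show ?thesis using isometric_op_in[OF T] by auto
qed

end

section \<open>Iteration for the operator square root\<close>

context semi_inner_product begin

text \<open>
  Writing a square root of \<open>1 - Y\<close> as \<open>1 - S\<close> turns the equation into
  \<open>S = (Y + S\<^sup>2) / 2\<close>, which is solved by iteration from \<open>0\<close>. All iterates are polynomials in \<open>Y\<close>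
  with nonnegative coefficients, so a contraction \<open>Y\<close> can be compared with the scalar \<open>1\<close>.
\<close>

primrec sqrt_defect :: "('v \<Rightarrow> 'v) \<Rightarrow> nat \<Rightarrow> 'v \<Rightarrow> 'v" where
  "sqrt_defect Y 0 = (\<lambda>x. 0)"
| "sqrt_defect Y (Suc n) = (\<lambda>x. (1/2) *\<^sub>C (Y x + sqrt_defect Y n (sqrt_defect Y n x)))"

end

text \<open>
The same iteration for the scalar \<open>Y = 1\<close>.
\<close>

primrec sqrt_defect_bound :: "nat \<Rightarrow> real" where
  "sqrt_defect_bound 0 = 0"
| "sqrt_defect_bound (Suc n) = (1 + (sqrt_defect_bound n)\<^sup>2) / 2"

lemma sqrt_defect_bound_nonneg: "0 \<le> sqrt_defect_bound n"
  and sqrt_defect_bound_le_1: "sqrt_defect_bound n \<le> 1"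
proof -
  have "0 \<le> sqrt_defect_bound n \<and> sqrt_defect_bound n \<le> 1"
    by (induction n) (auto intro: power_le_one)
  then show "0 \<le> sqrt_defect_bound n" "sqrt_defect_bound n \<le> 1" by auto
qed

text \<open>
The increment is \<open>(1 - s)\<^sup>2 / 2\<close> for the current value \<open>s\<close>.
\<close>

lemma sqrt_defect_bound_mono: "sqrt_defect_bound n \<le> sqrt_defect_bound (Suc n)"
proof -
  have "sqrt_defect_bound (Suc n) - sqrt_defect_bound n = (1 - sqrt_defect_bound n)\<^sup>2 / 2"
    by (simp add: power2_eq_square field_simps)
  also have "0 \<le> \<dots>" by simp
  finally show ?thesis by (simp del: sqrt_defect_bound.simps)
qed

lemma summable_sqrt_defect_bound_diff:
  "summable (\<lambda>n. sqrt_defect_bound (Suc n) - sqrt_defect_bound n)"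
proof -
  have "incseq sqrt_defect_bound"
    by (rule incseq_SucI) (rule sqrt_defect_bound_mono)
  then obtain l where "sqrt_defect_bound \<longlonglongrightarrow> l"
    using incseq_convergent[of sqrt_defect_bound 1] sqrt_defect_bound_le_1 by blast
  then show ?thesis by (rule telescope_summable)
qed

context semi_inner_product begin

context
  fixes Y assumes Y: "bounded_op 1 Y"
begin

lemma sqrt_defect_bounded: "bounded_op (sqrt_defect_bound n) (sqrt_defect Y n)"
proof (induction n)
  case 0
  then show ?case by (simp add: bounded_op_def linear_op_iff)
next
  case (Suc n)
  have "bounded_op (cmod (1/2) * (1 + sqrt_defect_bound n * sqrt_defect_bound n)) (sqrt_defect Y (Suc n))"
    unfolding sqrt_defect.simps
    by (rule bounded_op_scale[OF bounded_op_add[OF Y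
          bounded_op_comp[OF Suc.IH Suc.IH sqrt_defect_bound_nonneg]]])
  then show ?case by (simp add: power2_eq_square)
qed

lemma sqrt_defect_commute_mod_null:
  assumes "bounded_op J T" "commute_mod_null T Y"
  shows "commute_mod_null T (sqrt_defect Y n)"
proof (induction n)
  case 0
  then show ?case using linear_op_scale[OF bounded_op_linear[OF assms(1)], of 0 0]
    by (simp add: commute_mod_null_def)
next
  case (Suc n)
  note S = sqrt_defect_bounded[of n]
  note SS = bounded_op_comp[OF S S sqrt_defect_bound_nonneg]
  show ?case
    unfolding sqrt_defect.simps
    by (rule commute_mod_null_scale[OF assms(1) bounded_op_add[OF Y SS]
          commute_mod_null_add[OF assms(1) Y assms(2) SS
            commute_mod_null_comp[OF assms(1) S Suc.IH S Suc.IH]]])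
qed

lemma sqrt_defect_commute:
  assumes A: "linear_op A" and AY: "\<And>x. A (Y x) = Y (A x)"
  shows "A (sqrt_defect Y n x) = sqrt_defect Y n (A x)"
proof (induction n arbitrary: x)
  case 0
  then show ?case using linear_op_scale[OF A, of 0 0] by simp
next
  case (Suc n)
  then show ?case by (simp add: linear_op_add[OF A] linear_op_scale[OF A] AY)
qed

lemma sqrt_defect_commute_self:
  "sqrt_defect Y m (sqrt_defect Y n x) = sqrt_defect Y n (sqrt_defect Y m x)"
proof (rule sqrt_defect_commute[OF bounded_op_linear[OF sqrt_defect_bounded]])
  show "sqrt_defect Y m (Y x) = Y (sqrt_defect Y m x)" for x
    using sqrt_defect_commute[OF bounded_op_linear[OF Y], of m x] by simp
qed

text \<open>
  The iterates commute, so each increment is half the previous one times a sum of two iterates: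
  \<open>S'' - S' = (S' - S) (S' + S) / 2\<close>. The scalar iteration satisfies the same recursion, hence
  dominates.
\<close>

lemma sqrt_defect_step:
  assumes "x \<in> H"
  shows "nrm (sqrt_defect Y (Suc n) x - sqrt_defect Y n x)
    \<le> (sqrt_defect_bound (Suc n) - sqrt_defect_bound n) * nrm x"
  using assms
proof (induction n arbitrary: x)
  case 0
  then show ?case using bounded_op_nrm[OF Y, of x] bounded_op_in[OF Y, of x]
    by (simp add: nrm_scale)
next
  case (Suc n)
  let ?S = "sqrt_defect Y" and ?s = sqrt_defect_bound
  note inH = bounded_op_in[OF sqrt_defect_bounded]
  define z where "z = ?S (Suc n) x + ?S n x"
  have z: "z \<in> H" using Suc.prems by (auto simp: z_def simp del: sqrt_defect.simps intro!: H_add inH)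
  \<comment> \<open>The terms linear in \<open>Y\<close> cancel and a difference of squares remains.\<close>
  have "?S (Suc (Suc n)) x - ?S (Suc n) x
      = (1/2) *\<^sub>C (?S (Suc n) (?S (Suc n) x) - ?S n (?S n x))"
    by (simp only: sqrt_defect.simps(2)[of Y "Suc n"] sqrt_defect.simps(2)[of Y n, THEN fun_cong, of x]
          scale_right_diff_distrib[symmetric]) simp
  also have "?S (Suc n) (?S (Suc n) x) - ?S n (?S n x) = ?S (Suc n) z - ?S n z"
    using sqrt_defect_commute_self[of "Suc n" n x]
    by (simp add: z_def linear_op_add[OF bounded_op_linear[OF sqrt_defect_bounded]] del: sqrt_defect.simps)
  finally have "nrm (?S (Suc (Suc n)) x - ?S (Suc n) x) = (1/2) * nrm (?S (Suc n) z - ?S n z)"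
    using inH[OF z, of "Suc n"] inH[OF z, of n] by (simp add: nrm_scale del: sqrt_defect.simps)
  also have "\<dots> \<le> (1/2) * ((?s (Suc n) - ?s n) * nrm z)"
    using Suc.IH[OF z] by simp
  also have "\<dots> \<le> (1/2) * ((?s (Suc n) - ?s n) * ((?s (Suc n) + ?s n) * nrm x))"
  proof -
    have "nrm z \<le> nrm (?S (Suc n) x) + nrm (?S n x)"
      unfolding z_def using Suc.prems by (intro nrm_triangle inH)
    also have "\<dots> \<le> (?s (Suc n) + ?s n) * nrm x"
      using bounded_op_nrm[OF sqrt_defect_bounded Suc.prems, of n]
        bounded_op_nrm[OF sqrt_defect_bounded Suc.prems, of "Suc n"]
      by (simp only: distrib_right)
    finally have "nrm z \<le> (?s (Suc n) + ?s n) * nrm x" .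
    then show ?thesis
      using sqrt_defect_bound_mono[of n] by (intro mult_left_mono) (auto simp del: sqrt_defect_bound.simps)
  qed
  also have "\<dots> = (?s (Suc (Suc n)) - ?s (Suc n)) * nrm x"
  proof -
    have "?s (Suc (Suc n)) - ?s (Suc n) = (1/2) * ((?s (Suc n))\<^sup>2 - (?s n)\<^sup>2)"
      by (simp only: sqrt_defect_bound.simps(2)[of "Suc n"] sqrt_defect_bound.simps(2)[of n])
         (simp add: field_simps)
    also have "\<dots> = (1/2) * ((?s (Suc n) - ?s n) * (?s (Suc n) + ?s n))"
      by (simp only: power2_eq_square square_diff_square_factored mult.commute)
    finally show ?thesis by (simp only: mult.assoc)
  qed
  finally show ?case .
qed

end

end

section \<open>Invariant subspaces of isometries\<close>

context semi_hilbert begin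

text \<open>
  This replaces the spectral theorem. With \<open>R = \<bar>B\<bar>\<close>, obtained as the limit of \<open>R\<^sub>n = 1 - S\<^sub>n\<close> with
  \<open>S\<^sub>n\<close> the iterates for \<open>1 - B\<^sup>2\<close>, one has \<open>(R - B) (R + B) = R\<^sup>2 - B\<^sup>2 = 0\<close>. The kernel of \<open>R - B\<close>
  is closed and invariant under everything that commutes with \<open>B\<close>. Were it trivial, either
  \<open>R = B\<close>, or \<open>R + B = 0\<close> because the kernel contains the range of \<open>R + B\<close>. The real part of the
  form of \<open>R\<close> is nonnegative since \<open>S\<^sub>n\<close> is a contraction, so the real part of the form of \<open>B\<close>
  has a fixed sign in both cases.
\<close>

lemma invariant_or_definite:
  assumes B: "bounded_op 1 B" and Y: "bounded_op 1 (\<lambda>x. x - B (B x))"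
    and T: "isometric_op T" and comm: "commute_mod_null T B"
    and none: "\<nexists>S. nontrivial_invariant T S"
  shows "(\<forall>x\<in>H. 0 \<le> Re (ip (B x) x)) \<or> (\<forall>x\<in>H. Re (ip (B x) x) \<le> 0)"
proof -
  define Z where "Z = (\<lambda>x. x - B (B x))"
  define S where "S = sqrt_defect Z"
  let ?s = sqrt_defect_bound
  have Z: "bounded_op 1 Z" using Y by (simp add: Z_def)
  note Tb = isometric_op_bounded[OF T]
  note linB = bounded_op_linear[OF B] and inB = bounded_op_in[OF B]
  have S': "bounded_op (?s n) (S n)" for n unfolding S_def by (rule sqrt_defect_bounded[OF Z])
  note linS = bounded_op_linear[OF S'] and inS = bounded_op_in[OF S']
  have S: "bounded_op 1 (S n)" for n
  proof -
    have "nrm (S n x) \<le> 1 * nrm x" if "x \<in> H" for x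
      using bounded_op_nrm[OF S' that, of n] mult_right_mono[OF sqrt_defect_bound_le_1 nrm_nonneg[OF that]]
      by (rule order_trans)
    then show ?thesis
      using linS[of n] inS[of _ n] unfolding bounded_op_def by simp
  qed
  have BS: "B (S n x) = S n (B x)" for n x
    unfolding S_def
    by (rule sqrt_defect_commute[OF Z linB]) (simp add: Z_def linear_op_diff[OF linB])
  define A where "A = (\<lambda>n x. (x - S n x) - B x)"
  define C where "C = (\<lambda>n x. (x - S n x) + B x)"
  have A: "bounded_op (1 + 1 + 1) (A n)" for n
    unfolding A_def by (intro bounded_op_diff[OF bounded_op_diff[OF bounded_op_id S] B])
  have Cb: "bounded_op (1 + 1 + 1) (C n)" for n
    unfolding C_def by (intro bounded_op_add[OF bounded_op_diff[OF bounded_op_id S] B])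
  note inA = bounded_op_in[OF A] and inC = bounded_op_in[OF Cb]
  have TZ: "commute_mod_null T Z"
    unfolding Z_def
    by (rule commute_mod_null_diff[OF Tb bounded_op_id commute_mod_null_id
          bounded_op_comp[OF B B] commute_mod_null_comp[OF Tb B comm B comm]]) simp
  have TA: "commute_mod_null T (A n)" for n
    unfolding A_def
    by (rule commute_mod_null_diff[OF Tb bounded_op_diff[OF bounded_op_id S]
          commute_mod_null_diff[OF Tb bounded_op_id commute_mod_null_id S] B comm])
       (simp add: S_def sqrt_defect_commute_mod_null[OF Z Tb TZ])
  define K where "K = {x \<in> H. (\<lambda>n. nrm (A n x)) \<longlonglongrightarrow> 0}"
  have "closed_subspace K" unfolding K_def by (rule null_limit_closed_subspace[OF A])
  moreover have "T ` K \<subseteq> K" unfolding K_def by (rule null_limit_invariant[OF A T TA])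
  ultimately have "K = H \<or> (\<forall>x\<in>K. nrm x = 0)"
    using none unfolding nontrivial_invariant_def by blast
  have R_nonneg: "0 \<le> Re (ip (x - S n x) x)" if x: "x \<in> H" for n x
  proof -
    have "Re (ip (S n x) x) \<le> nrm (S n x) * nrm x"
      using x inS by (intro Re_Cauchy_Schwarz)
    also have "\<dots> \<le> nrm x * nrm x"
      using bounded_op_nrm[OF S x] x by (intro mult_right_mono) simp_all
    finally show ?thesis
      using x inS[OF x, of n] nrm_squared[OF x] by (simp add: ip_diff_left power2_eq_square)
  qed
  from \<open>K = H \<or> (\<forall>x\<in>K. nrm x = 0)\<close> show ?thesis
  proof
    assume KH: "K = H"
    have "0 \<le> Re (ip (B x) x)" if x: "x \<in> H" for x
    proof (rule LIMSEQ_le_const[where a = 0])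
      have "(\<lambda>n. nrm (A n x) * nrm x) \<longlonglongrightarrow> 0 * nrm x"
        using KH x K_def by (intro tendsto_mult tendsto_const) auto
      from tendsto_add[OF tendsto_const[of "Re (ip (B x) x)"] this]
      show "(\<lambda>n. Re (ip (B x) x) + nrm (A n x) * nrm x) \<longlonglongrightarrow> Re (ip (B x) x)"
        by simp
      have "0 \<le> Re (ip (B x) x) + nrm (A n x) * nrm x" for n
      proof -
        have "Re (ip (A n x) x) = Re (ip (x - S n x) x) - Re (ip (B x) x)"
          using x inS inB by (simp add: A_def ip_diff_left)
        then show ?thesis
          using R_nonneg[OF x, of n] Re_Cauchy_Schwarz[OF inA[OF x] x, of n] by simp
      qed
      then show "\<exists>N. \<forall>n\<ge>N. 0 \<le> Re (ip (B x) x) + nrm (A n x) * nrm x" by blast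
    qed
    then show ?thesis by blast
  next
    assume null: "\<forall>x\<in>K. nrm x = 0"
    have "Re (ip (B x) x) \<le> 0" if x: "x \<in> H" for x
    proof -
      have "\<exists>y\<in>H. (\<lambda>n. nrm (y - S n x)) \<longlonglongrightarrow> 0"
      proof (rule complete_telescope)
        show "summable (\<lambda>n. (?s (Suc n) - ?s n) * nrm x)"
          by (rule summable_mult2[OF summable_sqrt_defect_bound_diff])
        show "nrm (S (Suc n) x - S n x) \<le> (?s (Suc n) - ?s n) * nrm x" for n
          unfolding S_def by (rule sqrt_defect_step[OF Z x])
      qed (rule inS[OF x])
      then obtain y where y: "y \<in> H" "(\<lambda>n. nrm (y - S n x)) \<longlonglongrightarrow> 0" by blast
      \<comment> \<open>This is the vector \<open>(R + B) x\<close>.\<close>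
      define z where "z = (x - y) + B x"
      have z: "z \<in> H" using x y inB by (simp add: z_def)
      have zC: "nrm (z - C n x) = nrm (y - S n x)" for n
      proof -
        have "z - C n x = S n x - y" by (simp add: z_def C_def)
        then show ?thesis using nrm_minus_commute[OF y(1) inS[OF x]] by simp
      qed
      \<comment> \<open>\<open>R\<^sub>n\<^sup>2 - B\<^sup>2 = 2 (S\<^sub>n\<^sub>+\<^sub>1 - S\<^sub>n)\<close>, which tends to zero.\<close>
      have AC: "A n (C n x) = 2 *\<^sub>C (S (Suc n) x - S n x)" for n
      proof -
        have "2 *\<^sub>C S (Suc n) x = x - B (B x) + S n (S n x)"
          by (simp add: S_def Z_def)
        then show ?thesis
          using scale_left_distrib[of 1 1 "S n x"]
          by (simp add: A_def C_def scale_right_diff_distrib linear_op_add[OF linS]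
              linear_op_diff[OF linS] linear_op_add[OF linB] linear_op_diff[OF linB] BS)
      qed
      have "(\<lambda>n. nrm (A n z)) \<longlonglongrightarrow> 0"
      proof (rule tendsto_sandwich[where f = "\<lambda>_. 0" and
            h = "\<lambda>n. 3 * nrm (y - S n x) + 2 * ((?s (Suc n) - ?s n) * nrm x)"])
        have "nrm (A n z) \<le> 3 * nrm (y - S n x) + 2 * ((?s (Suc n) - ?s n) * nrm x)" for n
        proof -
          have "A n z = A n (z - C n x) + A n (C n x)"
            by (simp flip: linear_op_add[OF bounded_op_linear[OF A]])
          then have "nrm (A n z) \<le> nrm (A n (z - C n x)) + nrm (A n (C n x))"
            using nrm_triangle[OF inA inA, of "z - C n x" "C n x" n n] z inC[OF x] by simp
          moreover have "nrm (A n (z - C n x)) \<le> 3 * nrm (y - S n x)"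
            using bounded_op_nrm[OF A, of "z - C n x" n] z inC[OF x] zC by simp
          moreover have "nrm (A n (C n x)) \<le> 2 * ((?s (Suc n) - ?s n) * nrm x)"
            using sqrt_defect_step[OF Z x, of n] inS[OF x] unfolding AC S_def[symmetric]
            by (simp add: nrm_scale)
          ultimately show ?thesis by linarith
        qed
        then show "\<forall>\<^sub>F n in sequentially. nrm (A n z)
            \<le> 3 * nrm (y - S n x) + 2 * ((?s (Suc n) - ?s n) * nrm x)"
          by (rule always_eventually[OF allI])
        have "(\<lambda>n. 3 * nrm (y - S n x) + 2 * ((?s (Suc n) - ?s n) * nrm x)) \<longlonglongrightarrow> 3 * 0 + 2 * (0 * nrm x)"
          by (intro tendsto_intros y summable_LIMSEQ_zero[OF summable_sqrt_defect_bound_diff])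
        then show "(\<lambda>n. 3 * nrm (y - S n x) + 2 * ((?s (Suc n) - ?s n) * nrm x)) \<longlonglongrightarrow> 0"
          by simp
      qed (use inA[OF z] in auto)
      then have "z \<in> K" using z by (simp add: K_def)
      then have "nrm z = 0" using null by blast
      have "0 \<le> nrm (y - S n x) * nrm x - Re (ip (B x) x)" for n
      proof -
        have "ip (z - (z - C n x)) x = - ip (z - C n x) x"
          using ip_null(1)[OF z x \<open>nrm z = 0\<close>] z x inC by (simp add: ip_diff_left)
        then have "Re (ip (C n x) x) = - Re (ip (z - C n x) x)" by simp
        also have "\<dots> \<le> nrm (z - C n x) * nrm x"
          using Cauchy_Schwarz[of "z - C n x" x] abs_Re_le_cmod[of "ip (z - C n x) x"] z x inC[OF x]
          by (auto simp: abs_le_iff)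
        finally have "Re (ip (C n x) x) \<le> nrm (y - S n x) * nrm x" by (simp only: zC)
        moreover have "Re (ip (C n x) x) = Re (ip (x - S n x) x) + Re (ip (B x) x)"
          using x inS inB by (simp add: C_def ip_add_left)
        ultimately show ?thesis using R_nonneg[OF x, of n] by simp
      qed
      moreover have "(\<lambda>n. nrm (y - S n x) * nrm x - Re (ip (B x) x)) \<longlonglongrightarrow> 0 * nrm x - Re (ip (B x) x)"
        by (intro tendsto_intros y)
      ultimately have "0 \<le> 0 * nrm x - Re (ip (B x) x)"
        by (intro LIMSEQ_le_const[where a = 0]) auto
      then show ?thesis by simp
    qed
    then show ?thesis by blast
  qed
qed

text \<open>
  If the range of the isometry is not dense, its closure is the required subspace. Otherwise \<open>T\<close>
  has an inverse \<open>V\<close>, which is also its adjoint, and the self-adjoint contraction \<open>B = (T + V) / 2\<close>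
  commutes with \<open>T\<close>. Here \<open>1 - B\<^sup>2 = 1/2 - (T\<^sup>2 + V\<^sup>2) / 4\<close> is visibly a contraction.
\<close>

lemma isometric_definite:
  assumes T: "isometric_op T" and none: "\<nexists>S. nontrivial_invariant T S"
  shows "(\<forall>x\<in>H. 0 \<le> Re (ip (T x) x)) \<or> (\<forall>x\<in>H. Re (ip (T x) x) \<le> 0)"
proof (cases "\<exists>x\<in>H. nrm x \<noteq> 0")
  case False
  then show ?thesis using ip_null(2) isometric_op_in[OF T] by fastforce
next
  case True
  note inT = isometric_op_in[OF T] and nT = isometric_op_nrm[OF T]
  note linT = isometric_op_linear[OF T]
  let ?S = "{x \<in> H. \<forall>e>0. \<exists>y\<in>H. nrm (x - T y) < e}"
  have TS: "T x \<in> ?S" if "x \<in> H" for x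
    using that inT by (auto intro!: bexI[of _ x])
  have "?S = H"
  proof (rule ccontr)
    assume "?S \<noteq> H"
    moreover obtain x where "x \<in> H" "nrm (T x) \<noteq> 0" using True nT by auto
    ultimately have "nontrivial_invariant T ?S"
      using closure_range_closed[OF T] TS unfolding nontrivial_invariant_def by blast
    then show False using none by blast
  qed
  then have "\<And>x e. \<lbrakk>x \<in> H; e > 0\<rbrakk> \<Longrightarrow> \<exists>y\<in>H. nrm (x - T y) < e" by blast
  from isometric_dense_range_onto[OF T this] have onto: "\<And>x. x \<in> H \<Longrightarrow> \<exists>y\<in>H. nrm (x - T y) = 0" .
  obtain V where V: "isometric_op V" and TV: "\<And>x. x \<in> H \<Longrightarrow> nrm (T (V x) - x) = 0"
    and VT: "\<And>x. x \<in> H \<Longrightarrow> nrm (V (T x) - x) = 0"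
    using linear_inverse_mod_null[OF T onto] by metis
  note inV = isometric_op_in[OF V] and nV = isometric_op_nrm[OF V]
  note linV = isometric_op_linear[OF V]
  note Tb = isometric_op_bounded[OF T] and Vb = isometric_op_bounded[OF V]
  define B where "B = (\<lambda>x. (1/2) *\<^sub>C (T x + V x))"
  have B: "bounded_op 1 B"
    using bounded_op_scale[OF bounded_op_add[OF Tb Vb], of "1/2"] by (simp add: B_def)
  have ip_V: "ip (V x) y = ip x (T y)" if "x \<in> H" "y \<in> H" for x y
    using isometric_op_ip[OF T inV[OF that(1)] that(2)]
      ip_eq_if_close(1)[OF inT[OF inV[OF that(1)]] that(1) inT[OF that(2)] TV[OF that(1)]] by simp
  have "commute_mod_null T V"
    unfolding commute_mod_null_def
  proof
    fix x assume x: "x \<in> H"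
    have "nrm ((T (V x) - x) + (x - V (T x))) = 0"
      using TV[OF x] VT[OF x] nrm_minus_commute[OF x inV[OF inT[OF x]]] x inT inV
      by (intro nrm_add_null) simp_all
    then show "nrm (T (V x) - V (T x)) = 0" by simp
  qed
  moreover have "commute_mod_null T T" by (simp add: commute_mod_null_def)
  ultimately have comm: "commute_mod_null T B"
    unfolding B_def
    by (intro commute_mod_null_scale[OF Tb bounded_op_add[OF Tb Vb]] commute_mod_null_add[OF Tb Tb _ Vb])
  have "nrm (x - B (B x)) \<le> nrm x" if x: "x \<in> H" for x
  proof -
    define u where "u = (1/2) *\<^sub>C x - (1/4) *\<^sub>C (T (T x) + V (V x))"
    \<comment> \<open>The null vector \<open>n\<close> collects the failure of \<open>T V = V T = 1\<close> to hold exactly.\<close>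
    define n where "n = (-1/4) *\<^sub>C ((T (V x) - x) + (V (T x) - x))"
    have H: "T (T x) \<in> H" "V (V x) \<in> H" "T (V x) \<in> H" "V (T x) \<in> H"
      using x inT inV by auto
    have half: "(1/2) *\<^sub>C y = (1/4) *\<^sub>C y + (1/4) *\<^sub>C y" for y
      by (simp flip: scale_left_distrib)
    have "B (B x) = (1/4) *\<^sub>C (T (T x) + T (V x) + V (T x) + V (V x))"
      by (simp add: B_def linear_op_add[OF linT] linear_op_add[OF linV] linear_op_scale[OF linT]
          linear_op_scale[OF linV] scale_right_distrib)
    moreover have "x = (1/2) *\<^sub>C x + (1/2) *\<^sub>C x"
      by (simp flip: scale_left_distrib)
    ultimately have "x - B (B x) = u + n"
      unfolding u_def n_def
      by (simp add: scale_right_distrib scale_right_diff_distrib half)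
    moreover have "nrm ((T (V x) - x) + (V (T x) - x)) = 0"
      using TV[OF x] VT[OF x] x H by (intro nrm_add_null) simp_all
    then have "nrm n = 0" unfolding n_def using x H by (subst nrm_scale) simp_all
    moreover have "u \<in> H" "n \<in> H"
      unfolding u_def n_def using x H by (intro H_scale H_add H_diff; simp)+
    ultimately have "nrm (x - B (B x)) \<le> nrm u"
      using nrm_triangle[of u n] by simp
    also have "\<dots> \<le> nrm ((1/2) *\<^sub>C x) + nrm ((1/4) *\<^sub>C (T (T x) + V (V x)))"
      unfolding u_def using x H by (intro nrm_diff_le) simp_all
    also have "\<dots> \<le> (1/2) * nrm x + (1/4) * (nrm x + nrm x)"
      using nrm_triangle[of "T (T x)" "V (V x)"] x H nT inT nV inV by (simp add: nrm_scale)
    finally show ?thesis by simp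
  qed
  moreover have "bounded_op (1 + 1 * 1) (\<lambda>x. x - B (B x))"
    by (rule bounded_op_diff[OF bounded_op_id bounded_op_comp[OF B B]]) simp
  ultimately have "bounded_op 1 (\<lambda>x. x - B (B x))"
    unfolding bounded_op_def by simp
  from invariant_or_definite[OF B this T comm none]
  have "(\<forall>x\<in>H. 0 \<le> Re (ip (B x) x)) \<or> (\<forall>x\<in>H. Re (ip (B x) x) \<le> 0)" .
  moreover have "Re (ip (B x) x) = Re (ip (T x) x)" if x: "x \<in> H" for x
    using x inT[OF x] inV[OF x] ip_V[OF x x] Re_ip_commute[OF x inT[OF x]]
    by (simp add: B_def ip_scale_left ip_add_left)
  ultimately show ?thesis by simp
qed


text \<open>
  By polarization \<open>T\<close> is symmetric, so \<open>T\<^sup>2 = 1\<close> weakly and \<open>T g = - g\<close> weakly for \<open>g = x - T x\<close>.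
  Nonnegativity then leaves no room for \<open>g\<close>.
\<close>

lemma nonneg_isometric_eq_id:
  assumes T: "isometric_op T" and pos: "\<And>x. x \<in> H \<Longrightarrow> Im (ip (T x) x) = 0 \<and> 0 \<le> Re (ip (T x) x)"
    and x: "x \<in> H"
  shows "nrm (x - T x) = 0"
proof -
  note inT = isometric_op_in[OF T] and linT = isometric_op_linear[OF T]
  have sym: "ip (T a) b = ip a (T b)" if ab: "a \<in> H" "b \<in> H" for a b
  proof -
    have herm: "ip (T c) c = ip c (T c)" if "c \<in> H" for c
      using pos[OF that] ip_commute[OF inT[OF that] that] by (simp add: complex_eq_iff)
    have "ip (T a) b + ip (T b) a = ip a (T b) + ip b (T a)"
      using herm[of "a + b"] herm[OF ab(1)] herm[OF ab(2)] ab inT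
      by (simp add: linear_op_add[OF linT] ip_add_left ip_add_right add.commute)
    moreover have "\<i> * ip (T a) b - \<i> * ip (T b) a = \<i> * ip a (T b) - \<i> * ip b (T a)"
      using herm[of "\<i> *\<^sub>C a + b"] herm[OF ab(1)] herm[OF ab(2)] ab inT
      by (simp add: linear_op_add[OF linT] linear_op_scale[OF linT] ip_add_left ip_add_right
          ip_scale_left ip_scale_right) (simp add: algebra_simps)
    then have "ip (T a) b - ip (T b) a = ip a (T b) - ip b (T a)"
      by (simp flip: right_diff_distrib)
    ultimately have "2 * ip (T a) b = 2 * ip a (T b)" by algebra
    then show ?thesis by simp
  qed
  note H = x inT[OF x] inT[OF inT[OF x]]
  define g where "g = x - T x"
  have g: "g \<in> H" using H by (simp add: g_def)
  have Tg: "T g = T x - T (T x)" by (simp add: g_def linear_op_diff[OF linT])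
  have "ip (T (T x)) x = ip x x"
    using sym[OF H(2) H(1)] isometric_op_ip[OF T x x] by simp
  then have "ip (T g) g = - ip g g"
    using sym[OF x x] isometric_op_ip[OF T x x] isometric_op_ip[OF T H(2) x] H
    unfolding Tg by (simp add: g_def ip_diff_left ip_diff_right)
  then have "(nrm g)\<^sup>2 \<le> 0"
    using pos[OF g] nrm_squared[OF g] by simp
  then show ?thesis by (simp add: g_def)
qed

lemma isometric_op_unit_scale:
  assumes T: "isometric_op T" and c: "cmod c = 1"
  shows "isometric_op (\<lambda>x. c *\<^sub>C T x)"
  using bounded_op_linear[OF bounded_op_scale[OF isometric_op_bounded[OF T], of c]]
    isometric_op_in[OF T] isometric_op_nrm[OF T] c
  by (simp add: isometric_op_def nrm_scale)

lemma nontrivial_invariant_unscale: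
  assumes "nontrivial_invariant (\<lambda>x. c *\<^sub>C T x) S" "c \<noteq> 0"
  shows "nontrivial_invariant T S"
proof -
  have sub: "subspace S" and inv: "\<And>x. x \<in> S \<Longrightarrow> c *\<^sub>C T x \<in> S"
    using assms(1) unfolding nontrivial_invariant_def closed_subspace_def by auto
  have "T x \<in> S" if "x \<in> S" for x
    using subspace_scale[OF sub inv[OF that], of "inverse c"] assms(2) by simp
  then show ?thesis using assms(1) unfolding nontrivial_invariant_def by blast
qed

text \<open>
  Every subspace is invariant under a scalar. The orthogonal complement of \<open>f\<close> is used because it is
  evidently closed. It misses \<open>f\<close> and contains the component of \<open>g\<close> orthogonal to \<open>f\<close>.
\<close>

lemma scalar_nontrivial_invariant:
  assumes T: "\<And>x. x \<in> H \<Longrightarrow> T x \<in> H" "\<And>x. x \<in> H \<Longrightarrow> nrm (T x - c *\<^sub>C x) = 0"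
    and fg: "f \<in> H" "g \<in> H" "\<And>a b. nrm (a *\<^sub>C f + b *\<^sub>C g) = 0 \<Longrightarrow> a = 0 \<and> b = 0"
  shows "\<exists>S. nontrivial_invariant T S"
proof -
  define S where "S = {x \<in> H. ip x f = 0}"
  have "nrm f \<noteq> 0" using fg(3)[of 1 0] by auto
  then have ff: "ip f f \<noteq> 0" using ip_self[OF fg(1)] by simp
  have "closed_subspace S"
    unfolding closed_subspace_def
  proof (intro conjI ballI impI)
    show "subspace S"
      by (rule subspaceI) (use fg(1) in \<open>auto simp: S_def ip_add_left ip_scale_left ip_null(1)\<close>)
    fix x assume x: "x \<in> H" and app: "\<forall>e>0. \<exists>y\<in>S. nrm (x - y) < e"
    have "cmod (ip x f) \<le> 0 + e" if e: "e > 0" for e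
    proof -
      have "e / (nrm f + 1) > 0" using e fg(1) by (simp add: add_nonneg_pos)
      then obtain y where y: "y \<in> S" "nrm (x - y) < e / (nrm f + 1)" using app by blast
      then have yH: "y \<in> H" and "ip x f = ip (x - y) f"
        using x fg(1) by (auto simp: S_def ip_diff_left)
      then have "cmod (ip x f) \<le> nrm (x - y) * nrm f"
        using Cauchy_Schwarz[of "x - y" f] x fg(1) by simp
      also have "\<dots> \<le> nrm (x - y) * (nrm f + 1)"
        using x yH by (intro mult_left_mono) simp_all
      also have "\<dots> \<le> e"
        using y(2) fg(1) by (simp add: pos_less_divide_eq add_nonneg_pos less_imp_le)
      finally show ?thesis by simp
    qed
    then have "cmod (ip x f) \<le> 0" by (rule field_le_epsilon)
    then show "x \<in> S" using x by (simp add: S_def)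
  qed (auto simp: S_def)
  moreover have "\<exists>x\<in>S. nrm x \<noteq> 0"
  proof
    define a where "a = - ip g f / ip f f"
    show "a *\<^sub>C f + 1 *\<^sub>C g \<in> S"
      using fg ff by (simp add: S_def a_def ip_diff_left ip_scale_left)
    show "nrm (a *\<^sub>C f + 1 *\<^sub>C g) \<noteq> 0" using fg(3)[of a 1] by auto
  qed
  moreover have "S \<noteq> H" using ff fg(1) by (auto simp: S_def)
  moreover have "T ` S \<subseteq> S"
    using T fg(1) ip_eq_if_close(1)[OF T(1) H_scale fg(1) T(2)]
    by (auto simp: S_def ip_scale_left)
  ultimately show ?thesis unfolding nontrivial_invariant_def by blast
qed

text \<open>
  If there were no such subspace, then for every unit \<open>c\<close> the numbers \<open>Re (c \<langle>T x, x\<rangle>)\<close> would have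
  one sign for all \<open>x\<close>: no line through the origin separates two values \<open>\<langle>T x, x\<rangle>\<close>. All of them
  then lie on a single ray, so a rotation of \<open>T\<close> is a nonnegative isometry, hence the identity,
  and \<open>T\<close> is a scalar.
\<close>

theorem isometric_op_has_nontrivial_invariant:
  assumes T: "isometric_op T"
    and fg: "f \<in> H" "g \<in> H" "\<And>a b. nrm (a *\<^sub>C f + b *\<^sub>C g) = 0 \<Longrightarrow> a = 0 \<and> b = 0"
  shows "\<exists>S. nontrivial_invariant T S"
proof (rule ccontr)
  assume none: "\<nexists>S. nontrivial_invariant T S"
  note inT = isometric_op_in[OF T]
  have unit: "(\<forall>x\<in>H. 0 \<le> Re (c * ip (T x) x)) \<or> (\<forall>x\<in>H. Re (c * ip (T x) x) \<le> 0)"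
    if c: "cmod c = 1" for c
  proof -
    have "c \<noteq> 0" using c by auto
    then have "\<nexists>S. nontrivial_invariant (\<lambda>x. c *\<^sub>C T x) S"
      using none nontrivial_invariant_unscale by blast
    from isometric_definite[OF isometric_op_unit_scale[OF T c] this]
    show ?thesis using inT by (simp add: ip_scale_left)
  qed
  have sign: "0 \<le> Re (c * ip (T x) x) * Re (c * ip (T y) y)" if "x \<in> H" "y \<in> H" for c x y
  proof (cases "c = 0")
    case False
    define u where "u = sgn c"
    have "cmod u = 1" and c: "c = of_real (cmod c) * u"
      using False by (simp_all add: u_def norm_sgn) (simp add: sgn_eq)
    from unit[OF this(1)] that
    have "0 \<le> Re (u * ip (T x) x) * Re (u * ip (T y) y)"
      by (auto intro: mult_nonneg_nonneg mult_nonpos_nonpos)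
    then have "0 \<le> (cmod c)\<^sup>2 * (Re (u * ip (T x) x) * Re (u * ip (T y) y))"
      by simp
    moreover have cs: "Re (c * v) = cmod c * Re (u * v)" for v
    proof -
      have cv: "c * v = of_real (cmod c) * (u * v)"
        using arg_cong[OF c, of "\<lambda>t. t * v"] by (simp only: mult.assoc)
      show ?thesis by (subst cv) simp
    qed
    ultimately show ?thesis unfolding cs by (simp only: power2_eq_square mult_ac)
  qed simp
  have "\<exists>x\<in>H. ip (T x) x \<noteq> 0"
  proof (rule ccontr)
    assume zero: "\<not> (\<exists>x\<in>H. ip (T x) x \<noteq> 0)"
    then have "nrm (f - T f) = 0"
      using nonneg_isometric_eq_id[OF T _ fg(1)] by simp
    then have "ip (T f) f = ip f f"
      using ip_eq_if_close(1)[OF fg(1) inT[OF fg(1)] fg(1)] by simp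
    then show False using zero fg(1) ip_self[OF fg(1)] fg(3)[of 1 0] by auto
  qed
  then obtain x0 where x0: "x0 \<in> H" "ip (T x0) x0 \<noteq> 0" by blast
  define w where "w = ip (T x0) x0"
  have pos: "Im (cnj w * ip (T x) x) = 0 \<and> 0 \<le> Re (cnj w * ip (T x) x)" if x: "x \<in> H" for x
  proof -
    define z where "z = cnj w * ip (T x) x"
    have ww: "w * cnj w = of_real ((cmod w)\<^sup>2)" by (rule complex_norm_square[symmetric])
    have wpos: "0 < (cmod w)\<^sup>2" using x0 by (simp add: w_def)
    have s: "0 \<le> Re c * Re (c * z)" for c
    proof -
      have cw: "c * cnj w * ip (T x0) x0 = of_real ((cmod w)\<^sup>2) * c"
        using ww by (simp add: w_def[symmetric] mult_ac)
      have "Re (c * cnj w * ip (T x0) x0) = (cmod w)\<^sup>2 * Re c"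
        unfolding cw by (simp del: of_real_power)
      moreover have "c * cnj w * ip (T x) x = c * z" by (simp add: z_def)
      ultimately have "0 \<le> (cmod w)\<^sup>2 * (Re c * Re (c * z))"
        using sign[OF x0(1) x, of "c * cnj w"] by (simp only: mult.assoc)
      then show ?thesis using wpos by (simp add: zero_le_mult_iff)
    qed
    have "0 \<le> Re z" using s[of 1] by simp
    moreover have "Im z = 0"
    proof (rule ccontr)
      assume nz: "Im z \<noteq> 0"
      \<comment> \<open>Testing with \<open>e + \<i>\<close> for a small \<open>e\<close> of the sign of \<open>Im z\<close> puts \<open>1\<close> and \<open>z\<close> on opposite sides.\<close>
      define e where "e = Im z / (2 * (Re z + 1))"
      have "0 \<le> e * (e * Re z - Im z)" using s[of "Complex e 1"] by simp
      also have "e * Re z - Im z = - (Im z * (Re z + 2)) / (2 * (Re z + 1))"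
        using \<open>0 \<le> Re z\<close> by (simp add: e_def field_simps)
      also have "e * \<dots> = - ((Im z)\<^sup>2 * (Re z + 2)) / (2 * (Re z + 1))\<^sup>2"
        by (simp add: e_def power2_eq_square)
      also have "\<dots> < 0"
        using nz \<open>0 \<le> Re z\<close> by (simp add: divide_neg_pos)
      finally show False by simp
    qed
    ultimately show ?thesis by (simp add: z_def)
  qed
  define c where "c = cnj w / of_real (cmod w)"
  have c: "cmod c = 1" using x0 by (simp add: c_def w_def norm_divide)
  have "Im (ip (c *\<^sub>C T x) x) = 0 \<and> 0 \<le> Re (ip (c *\<^sub>C T x) x)" if x: "x \<in> H" for x
  proof -
    have "ip (c *\<^sub>C T x) x = cnj w * ip (T x) x / of_real (cmod w)"
      using x inT by (simp add: ip_scale_left c_def)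
    then show ?thesis using pos[OF x] by (simp add: Re_divide_of_real Im_divide_of_real)
  qed
  from nonneg_isometric_eq_id[OF isometric_op_unit_scale[OF T c] this]
  have id: "\<And>x. x \<in> H \<Longrightarrow> nrm (x - c *\<^sub>C T x) = 0" by blast
  have "nrm (T x - inverse c *\<^sub>C x) = 0" if x: "x \<in> H" for x
  proof -
    have "c \<noteq> 0" using c by auto
    then have "T x - inverse c *\<^sub>C x = (- inverse c) *\<^sub>C (x - c *\<^sub>C T x)"
      by (simp add: scale_right_diff_distrib)
    then show ?thesis using id[OF x] x inT[OF x] by (simp only: nrm_scale H_diff H_scale)
  qed
  from scalar_nontrivial_invariant[of T "inverse c" f g, OF inT this fg] show False
    using none by blast
qed

end

section \<open>The Hilbert space of square-integrable functions\<close>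

definition L2_ip :: "'a measure \<Rightarrow> ('a \<Rightarrow> complex) \<Rightarrow> ('a \<Rightarrow> complex) \<Rightarrow> complex" where
  "L2_ip M f g = (\<integral>x. f x * cnj (g x) \<partial>M)"

abbreviation (input) fun_scale :: "complex \<Rightarrow> ('a \<Rightarrow> complex) \<Rightarrow> ('a \<Rightarrow> complex)" where
  "fun_scale \<equiv> \<lambda>c f x. c * f x"

lemma L2_fun_measurable: "f \<in> L2_fun M \<Longrightarrow> f \<in> borel_measurable M"
  and L2_fun_integrable: "f \<in> L2_fun M \<Longrightarrow> integrable M (\<lambda>x. (cmod (f x))\<^sup>2)"
  by (simp_all add: L2_fun_def)

lemma L2_fun_bound:
  assumes "integrable M g" "f \<in> borel_measurable M" "\<And>x. (cmod (f x))\<^sup>2 \<le> g x"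
  shows "f \<in> L2_fun M"
proof -
  have "integrable M (\<lambda>x. (cmod (f x))\<^sup>2)"
  proof (rule Bochner_Integration.integrable_bound[OF assms(1)])
    show "(\<lambda>x. (cmod (f x))\<^sup>2) \<in> borel_measurable M" using assms(2) by measurable
    show "AE x in M. norm ((cmod (f x))\<^sup>2) \<le> norm (g x)"
      using assms(3) by (intro AE_I2) (smt (verit) norm_power real_norm_def zero_le_power2 abs_of_nonneg)
  qed
  then show ?thesis using assms(2) by (simp add: L2_fun_def)
qed

lemma cmod_mult_le_sum_squares: "cmod (a * b) \<le> (cmod a)\<^sup>2 + (cmod b)\<^sup>2"
proof -
  have "2 * (cmod a * cmod b) \<le> (cmod a)\<^sup>2 + (cmod b)\<^sup>2"
    using sum_squares_bound[of "cmod a" "cmod b"] by simp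
  moreover have "0 \<le> cmod a * cmod b" by simp
  ultimately show ?thesis unfolding norm_mult by linarith
qed

lemma cmod_add_squared_le: "(cmod (a + b))\<^sup>2 \<le> 2 * (cmod a)\<^sup>2 + 2 * (cmod b)\<^sup>2"
proof -
  have "(cmod (a + b))\<^sup>2 \<le> (cmod a + cmod b)\<^sup>2"
    by (intro power_mono norm_triangle_ineq) simp
  also have "\<dots> \<le> 2 * (cmod a)\<^sup>2 + 2 * (cmod b)\<^sup>2"
    using sum_squares_bound[of "cmod a" "cmod b"] by (simp add: power2_sum)
  finally show ?thesis .
qed

lemma L2_fun_add:
  assumes "f \<in> L2_fun M" "g \<in> L2_fun M"
  shows "(\<lambda>x. f x + g x) \<in> L2_fun M"
proof (rule L2_fun_bound)
  show "integrable M (\<lambda>x. 2 * (cmod (f x))\<^sup>2 + 2 * (cmod (g x))\<^sup>2)"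
    using assms[THEN L2_fun_integrable] by simp
  show "(\<lambda>x. f x + g x) \<in> borel_measurable M"
    using assms[THEN L2_fun_measurable] by measurable
qed (rule cmod_add_squared_le)

lemma L2_fun_scale:
  assumes "f \<in> L2_fun M"
  shows "(\<lambda>x. c * f x) \<in> L2_fun M"
proof (rule L2_fun_bound)
  show "integrable M (\<lambda>x. (cmod c)\<^sup>2 * (cmod (f x))\<^sup>2)"
    using L2_fun_integrable[OF assms] by simp
  show "(\<lambda>x. c * f x) \<in> borel_measurable M"
    using L2_fun_measurable[OF assms] by measurable
qed (simp add: norm_mult power_mult_distrib)

lemma L2_ip_integrable:
  assumes "f \<in> L2_fun M" "g \<in> L2_fun M"
  shows "integrable M (\<lambda>x. f x * cnj (g x))"
proof (rule Bochner_Integration.integrable_bound)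
  show "integrable M (\<lambda>x. (cmod (f x))\<^sup>2 + (cmod (g x))\<^sup>2)"
    using assms[THEN L2_fun_integrable] by simp
  have "(\<lambda>x. cnj (g x)) \<in> borel_measurable M"
    using L2_fun_measurable[OF assms(2)]
    by (rule measurable_compose) (intro borel_measurable_continuous_onI continuous_intros)
  then show "(\<lambda>x. f x * cnj (g x)) \<in> borel_measurable M"
    using L2_fun_measurable[OF assms(1)] by measurable
  show "AE x in M. norm (f x * cnj (g x)) \<le> norm ((cmod (f x))\<^sup>2 + (cmod (g x))\<^sup>2)"
  proof (rule AE_I2)
    fix x
    show "norm (f x * cnj (g x)) \<le> norm ((cmod (f x))\<^sup>2 + (cmod (g x))\<^sup>2)"
      using cmod_mult_le_sum_squares[of "f x" "cnj (g x)"] by simp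
  qed
qed

lemma L2_ip_self:
  shows "L2_ip M f f = of_real (\<integral>x. (cmod (f x))\<^sup>2 \<partial>M)"
proof -
  have "L2_ip M f f = (\<integral>x. of_real ((cmod (f x))\<^sup>2) \<partial>M)"
    unfolding L2_ip_def complex_norm_square ..
  then show ?thesis by (simp only: integral_complex_of_real)
qed

lemma L2_vector_space: "vector_space fun_scale"
  by unfold_locales (auto simp: fun_eq_iff algebra_simps)

lemma L2_semi_inner_product: "semi_inner_product fun_scale (L2_fun M) (L2_ip M)"
proof -
  interpret vector_space fun_scale by (rule L2_vector_space)
  show ?thesis
  proof unfold_locales
    show "subspace (L2_fun M)"
      by (rule subspaceI)
         (auto simp: zero_fun_def plus_fun_def L2_fun_add L2_fun_scale, simp add: L2_fun_def)
    fix f g k :: "'a \<Rightarrow> complex" and c :: complex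
    assume fg: "f \<in> L2_fun M" "g \<in> L2_fun M"
    show "L2_ip M (\<lambda>x. c * f x) g = c * L2_ip M f g"
      by (simp add: L2_ip_def mult.assoc)
    show "L2_ip M g f = cnj (L2_ip M f g)"
    proof -
      have "cnj (L2_ip M f g) = (\<integral>x. cnj (f x * cnj (g x)) \<partial>M)"
        unfolding L2_ip_def by (rule Bochner_Integration.integral_cnj[symmetric])
      then show ?thesis by (simp add: L2_ip_def mult.commute)
    qed
    show "0 \<le> Re (L2_ip M f f)"
      by (simp add: L2_ip_self)
    assume "k \<in> L2_fun M"
    then show "L2_ip M (f + g) k = L2_ip M f k + L2_ip M g k"
      using fg by (simp add: L2_ip_def distrib_right L2_ip_integrable)
  qed
qed

lemma L2_nn_integral:
  assumes "f \<in> L2_fun M"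
  shows "(\<integral>\<^sup>+x. ennreal ((cmod (f x))\<^sup>2) \<partial>M) = ennreal ((L2_seminorm M f)\<^sup>2)"
  using nn_integral_eq_integral[OF L2_fun_integrable[OF assms]]
  by (simp add: L2_seminorm_def)

lemma L2_seminorm_le:
  assumes f: "f \<in> borel_measurable M" and r: "0 \<le> r"
    and le: "(\<integral>\<^sup>+x. ennreal ((cmod (f x))\<^sup>2) \<partial>M) \<le> ennreal (r\<^sup>2)"
  shows "f \<in> L2_fun M" "L2_seminorm M f \<le> r"
proof -
  have "integrable M (\<lambda>x. (cmod (f x))\<^sup>2)"
    using f le by (intro integrableI_bounded) (auto simp: order_le_less_trans[OF le])
  then show fL: "f \<in> L2_fun M" using f by (simp add: L2_fun_def)
  have "(L2_seminorm M f)\<^sup>2 \<le> r\<^sup>2"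
    using le L2_nn_integral[OF fL] by simp
  then show "L2_seminorm M f \<le> r" using r by (rule power2_le_imp_le)
qed

lemma L2_nrm: "semi_inner_product.nrm (L2_ip M) f = L2_seminorm M f"
  by (simp add: semi_inner_product.nrm_def[OF L2_semi_inner_product] L2_ip_self L2_seminorm_def)

lemma sum_fun_apply: "(\<Sum>i\<in>A. F i) x = (\<Sum>i\<in>A. F i x :: complex)"
  by (induction A rule: infinite_finite_induct) auto

lemma L2_sum:
  assumes "\<And>i. i \<in> A \<Longrightarrow> X i \<in> L2_fun M"
  shows "(\<lambda>x. \<Sum>i\<in>A. X i x) \<in> L2_fun M"
    and "L2_seminorm M (\<lambda>x. \<Sum>i\<in>A. X i x) \<le> (\<Sum>i\<in>A. L2_seminorm M (X i))"
proof -
  interpret semi_inner_product fun_scale "L2_fun M" "L2_ip M" by (rule L2_semi_inner_product)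
  have "(\<lambda>x. \<Sum>i\<in>A. X i x) \<in> L2_fun M \<and>
    L2_seminorm M (\<lambda>x. \<Sum>i\<in>A. X i x) \<le> (\<Sum>i\<in>A. L2_seminorm M (X i))"
    using assms
  proof (induction A rule: infinite_finite_induct)
    case (insert a A)
    then have "L2_seminorm M (X a + (\<lambda>x. \<Sum>i\<in>A. X i x))
        \<le> L2_seminorm M (X a) + L2_seminorm M (\<lambda>x. \<Sum>i\<in>A. X i x)"
      using nrm_triangle[of "X a" "\<lambda>x. \<Sum>i\<in>A. X i x"] by (simp add: L2_nrm)
    then show ?case using insert by (auto simp: plus_fun_def L2_fun_add)
  qed (auto simp: L2_fun_def L2_seminorm_def)
  then show "(\<lambda>x. \<Sum>i\<in>A. X i x) \<in> L2_fun M"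
    and "L2_seminorm M (\<lambda>x. \<Sum>i\<in>A. X i x) \<le> (\<Sum>i\<in>A. L2_seminorm M (X i))" by auto
qed

lemma L2_seminorm_nonneg: "0 \<le> L2_seminorm M f"
  by (simp add: L2_seminorm_def)

text \<open>
  By the triangle inequality the partial sums of \<open>\<Sum>n. \<bar>X n\<bar>\<close> are bounded in \<open>L\<^sup>2\<close>, so by monotone
  convergence the square of the full sum has a finite integral.
\<close>

lemma L2_summable_AE:
  assumes X: "\<And>n::nat. X n \<in> L2_fun M" and sm: "summable (\<lambda>n. L2_seminorm M (X n))"
  shows "AE x in M. summable (\<lambda>n. cmod (X n x))"
proof -
  define G where "G = (\<lambda>n x. \<Sum>i<n. cmod (X i x))"
  define S where "S = (\<Sum>n. L2_seminorm M (X n))"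
  have meas [measurable]: "\<And>n. X n \<in> borel_measurable M" using X by (rule L2_fun_measurable)
  have G_bound: "(\<integral>\<^sup>+x. ennreal ((G n x)\<^sup>2) \<partial>M) \<le> ennreal (S\<^sup>2)" for n
  proof -
    define Y where "Y = (\<lambda>i x. complex_of_real (cmod (X i x)))"
    have Y: "Y i \<in> L2_fun M" "L2_seminorm M (Y i) = L2_seminorm M (X i)" for i
      using X[of i] by (simp_all add: Y_def L2_fun_def L2_seminorm_def)
    have "cmod (\<Sum>i<n. Y i x) = G n x" for x
      by (simp add: Y_def G_def flip: of_real_sum) (simp add: sum_nonneg)
    then have "(\<integral>\<^sup>+x. ennreal ((G n x)\<^sup>2) \<partial>M) = ennreal ((L2_seminorm M (\<lambda>x. \<Sum>i<n. Y i x))\<^sup>2)"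
      using L2_nn_integral[OF L2_sum(1)[of "{..<n}" Y M]] Y by simp
    also have "L2_seminorm M (\<lambda>x. \<Sum>i<n. Y i x) \<le> S"
      using L2_sum(2)[of "{..<n}" Y M] Y sum_le_suminf[OF sm, of "{..<n}"]
      by (simp add: S_def L2_seminorm_nonneg)
    then have "ennreal ((L2_seminorm M (\<lambda>x. \<Sum>i<n. Y i x))\<^sup>2) \<le> ennreal (S\<^sup>2)"
      by (intro ennreal_leI power_mono L2_seminorm_nonneg)
    finally show ?thesis .
  qed
  have "(\<integral>\<^sup>+x. (SUP n. ennreal ((G n x)\<^sup>2)) \<partial>M) = (SUP n. \<integral>\<^sup>+x. ennreal ((G n x)\<^sup>2) \<partial>M)"
  proof (rule nn_integral_monotone_convergence_SUP)
    show "incseq (\<lambda>n x. ennreal ((G n x)\<^sup>2))"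
      unfolding incseq_def le_fun_def G_def
      by (auto intro!: ennreal_leI power_mono sum_mono2 sum_nonneg)
  qed (simp add: G_def)
  also have "\<dots> \<le> ennreal (S\<^sup>2)" by (intro SUP_least G_bound)
  also have "\<dots> < \<infinity>" by simp
  finally have "AE x in M. (SUP n. ennreal ((G n x)\<^sup>2)) \<noteq> \<infinity>"
    by (intro nn_integral_noteq_infinite) (auto simp: G_def)
  then show ?thesis
  proof (rule AE_mp, intro AE_I2 impI)
    fix x assume fin: "(SUP n. ennreal ((G n x)\<^sup>2)) \<noteq> \<infinity>"
    then obtain r where r: "0 \<le> r" "(SUP n. ennreal ((G n x)\<^sup>2)) = ennreal r"
      by (metis ennreal_cases infinity_ennreal_def)
    have "G n x \<le> sqrt r" for n
    proof -
      have "ennreal ((G n x)\<^sup>2) \<le> ennreal r"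
        unfolding r(2)[symmetric] by (rule SUP_upper) simp
      then have "(G n x)\<^sup>2 \<le> r" using r(1) by simp
      then show ?thesis by (rule real_le_rsqrt)
    qed
    then show "summable (\<lambda>n. cmod (X n x))"
      by (intro summableI_nonneg_bounded[where x = "sqrt r"]) (auto simp: G_def)
  qed
qed

text \<open>
  Fatou's lemma bounds the norm of the remainder of the pointwise sum by the tail of the series of
  norms. The remainder after \<open>0\<close> terms also shows that the sum is square integrable.
\<close>

lemma L2_complete:
  assumes X: "\<And>n::nat. X n \<in> L2_fun M" and sm: "summable (\<lambda>n. L2_seminorm M (X n))"
  shows "\<exists>f\<in>L2_fun M. (\<lambda>n. L2_seminorm M (\<lambda>x. f x - (\<Sum>i<n. X i x))) \<longlonglongrightarrow> 0"
proof -
  have meas [measurable]: "\<And>n. X n \<in> borel_measurable M" using X by (rule L2_fun_measurable)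
  define f where "f = (\<lambda>x. \<Sum>n. X n x)"
  define t where "t = (\<lambda>n. \<Sum>i. L2_seminorm M (X (i + n)))"
  have f [measurable]: "f \<in> borel_measurable M" unfolding f_def by measurable
  have t0: "0 \<le> t n" for n
    unfolding t_def using sm by (intro suminf_nonneg summable_ignore_initial_segment) (simp_all add: L2_seminorm_nonneg)
  have tail: "(\<integral>\<^sup>+x. ennreal ((cmod (f x - (\<Sum>i<n. X i x)))\<^sup>2) \<partial>M) \<le> ennreal ((t n)\<^sup>2)" for n
  proof -
    let ?D = "\<lambda>m x. \<Sum>i<m. X (i + n) x"
    have lim: "AE x in M. (\<lambda>m. ennreal ((cmod (?D m x))\<^sup>2)) \<longlonglongrightarrow> ennreal ((cmod (f x - (\<Sum>i<n. X i x)))\<^sup>2)"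
      using L2_summable_AE[OF X sm]
    proof (rule AE_mp, intro AE_I2 impI)
      fix x assume "summable (\<lambda>n. cmod (X n x))"
      then have s: "summable (\<lambda>n. X n x)" by (rule summable_norm_cancel)
      then have "(\<lambda>m. ?D m x) \<longlonglongrightarrow> f x - (\<Sum>i<n. X i x)"
        using summable_LIMSEQ[OF summable_ignore_initial_segment[OF s, of n]]
        by (simp add: f_def suminf_minus_initial_segment[OF s])
      then show "(\<lambda>m. ennreal ((cmod (?D m x))\<^sup>2)) \<longlonglongrightarrow> ennreal ((cmod (f x - (\<Sum>i<n. X i x)))\<^sup>2)"
        by (intro tendsto_ennrealI tendsto_power tendsto_norm)
    qed
    have "(\<integral>\<^sup>+x. ennreal ((cmod (f x - (\<Sum>i<n. X i x)))\<^sup>2) \<partial>M)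
        = (\<integral>\<^sup>+x. liminf (\<lambda>m. ennreal ((cmod (?D m x))\<^sup>2)) \<partial>M)"
    proof (rule nn_integral_cong_AE)
      from lim show "AE x in M. ennreal ((cmod (f x - (\<Sum>i<n. X i x)))\<^sup>2)
          = liminf (\<lambda>m. ennreal ((cmod (?D m x))\<^sup>2))"
      proof eventually_elim
        case (elim x)
        from lim_imp_Liminf[OF sequentially_bot elim] show ?case by (rule sym)
      qed
    qed
    also have "\<dots> \<le> liminf (\<lambda>m. \<integral>\<^sup>+x. ennreal ((cmod (?D m x))\<^sup>2) \<partial>M)"
      by (intro nn_integral_liminf) measurable
    also have "\<dots> \<le> ennreal ((t n)\<^sup>2)"
    proof -
      have "(\<integral>\<^sup>+x. ennreal ((cmod (?D m x))\<^sup>2) \<partial>M) \<le> ennreal ((t n)\<^sup>2)" for m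
      proof -
        have "L2_seminorm M (?D m) \<le> (\<Sum>i<m. L2_seminorm M (X (i + n)))"
          using X by (intro L2_sum)
        also have "\<dots> \<le> t n"
          unfolding t_def using sm
          by (intro sum_le_suminf summable_ignore_initial_segment) (simp_all add: L2_seminorm_nonneg)
        finally have "ennreal ((L2_seminorm M (?D m))\<^sup>2) \<le> ennreal ((t n)\<^sup>2)"
          by (intro ennreal_leI power_mono L2_seminorm_nonneg)
        then show ?thesis
          using L2_nn_integral[OF L2_sum(1)[of "{..<m}" "\<lambda>i. X (i + n)" M]] X by simp
      qed
      then have "liminf (\<lambda>m. \<integral>\<^sup>+x. ennreal ((cmod (?D m x))\<^sup>2) \<partial>M) \<le> liminf (\<lambda>m::nat. ennreal ((t n)\<^sup>2))"
        by (intro Liminf_mono always_eventually allI)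
      then show ?thesis by (simp add: Liminf_const)
    qed
    finally show ?thesis .
  qed
  have le: "L2_seminorm M (\<lambda>x. f x - (\<Sum>i<n. X i x)) \<le> t n" for n
    by (rule L2_seminorm_le(2)[OF _ t0 tail]) measurable
  have "f \<in> L2_fun M"
    using L2_seminorm_le(1)[OF f t0, of 0] tail[of 0] by simp
  moreover have "t \<longlonglongrightarrow> 0"
    unfolding t_def by (rule suminf_exist_split2[OF sm])
  then have "(\<lambda>n. L2_seminorm M (\<lambda>x. f x - (\<Sum>i<n. X i x))) \<longlonglongrightarrow> 0"
    by (rule tendsto_sandwich[OF _ _ tendsto_const, rotated 2])
       (simp_all add: le L2_seminorm_nonneg always_eventually)
  ultimately show ?thesis by blast
qed

lemma L2_semi_hilbert: "semi_hilbert fun_scale (L2_fun M) (L2_ip M)"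
proof -
  interpret semi_inner_product fun_scale "L2_fun M" "L2_ip M" by (rule L2_semi_inner_product)
  show ?thesis
  proof unfold_locales
    fix X :: "nat \<Rightarrow> 'a \<Rightarrow> complex"
    assume "\<And>n. X n \<in> L2_fun M" "summable (\<lambda>n. nrm (X n))"
    then show "\<exists>f\<in>L2_fun M. (\<lambda>n. nrm (f - (\<Sum>i<n. X i))) \<longlonglongrightarrow> 0"
      using L2_complete[of X M] by (simp add: L2_nrm fun_diff_def sum_fun_apply)
  qed
qed

lemma L2_seminorm_eq_0_iff:
  assumes "f \<in> L2_fun M"
  shows "L2_seminorm M f = 0 \<longleftrightarrow> (AE x in M. f x = 0)"
  using integral_nonneg_eq_0_iff_AE[OF L2_fun_integrable[OF assms]] by (simp add: L2_seminorm_def)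

lemma L2_invariant_subspace_if_nontrivial_invariant:
  assumes "semi_inner_product.nontrivial_invariant fun_scale (L2_fun M) (L2_ip M) T S"
  shows "L2_has_nontrivial_invariant_subspace M T"
proof -
  interpret semi_inner_product fun_scale "L2_fun M" "L2_ip M" by (rule L2_semi_inner_product)
  have S: "S \<subseteq> L2_fun M" "subspace S" "\<exists>f\<in>S. nrm f \<noteq> 0" "S \<noteq> L2_fun M" "T ` S \<subseteq> S"
    and cl: "\<And>f. \<lbrakk>f \<in> L2_fun M; \<forall>e>0. \<exists>g\<in>S. nrm (f - g) < e\<rbrakk> \<Longrightarrow> f \<in> S"
    using assms unfolding nontrivial_invariant_def closed_subspace_def by auto
  have "L2_closed_subspace M S"
    using S(1,2) cl unfolding L2_closed_subspace_def subspace_def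
    by (simp add: zero_fun_def plus_fun_def fun_diff_def L2_nrm)
  moreover have "L2_nontrivial M S"
    using S(1,3,4) L2_seminorm_eq_0_iff unfolding L2_nontrivial_def L2_nrm by blast
  ultimately show ?thesis using S(5) unfolding L2_has_nontrivial_invariant_subspace_def by blast
qed

section \<open>Weighted composition operators\<close>

text \<open>
  Almost every point lies on the same side of each rational as almost every other point, so any
  single such point has the almost everywhere value.
\<close>

lemma AE_const_if_AE_dichotomy:
  fixes f :: "'a \<Rightarrow> ennreal"
  assumes "\<And>c. (AE x in M. f x < c) \<or> (AE x in M. c \<le> f x)"
  shows "\<exists>k. AE x in M. f x = k"
proof (cases "AE x in M. False")
  case True
  then show ?thesis by (auto elim: AE_mp)
next
  case False
  define b where "b = (\<lambda>q::rat. AE x in M. f x < ennreal (real_of_rat q))"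
  have "AE x in M. \<forall>q. f x < ennreal (real_of_rat q) \<longleftrightarrow> b q"
    unfolding AE_all_countable
  proof
    fix q
    from assms[of "ennreal (real_of_rat q)"]
    consider "b q" | "\<not> b q" "AE x in M. ennreal (real_of_rat q) \<le> f x"
      by (auto simp: b_def)
    then show "AE x in M. f x < ennreal (real_of_rat q) \<longleftrightarrow> b q"
    proof cases
      case 1
      then have "AE x in M. f x < ennreal (real_of_rat q)" by (simp add: b_def)
      then show ?thesis using 1 by (auto elim: AE_mp)
    next
      case 2
      from 2(2) show ?thesis by eventually_elim (use 2(1) in auto)
    qed
  qed
  note cut = this
  have "\<exists>x0. \<forall>q. f x0 < ennreal (real_of_rat q) \<longleftrightarrow> b q"
  proof (rule ccontr)
    assume none: "\<not> (\<exists>x0. \<forall>q. f x0 < ennreal (real_of_rat q) \<longleftrightarrow> b q)"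
    from cut have "AE x in M. False" by eventually_elim (use none in blast)
    with False show False ..
  qed
  then obtain x0 where x0: "\<And>q. f x0 < ennreal (real_of_rat q) \<longleftrightarrow> b q" by blast
  from cut have "AE x in M. f x = f x0"
  proof eventually_elim
    case (elim x)
    then have "f x < ennreal (real_of_rat q) \<longleftrightarrow> f x0 < ennreal (real_of_rat q)" for q
      using x0 by simp
    then have "\<not> f x < f x0" "\<not> f x0 < f x"
      using ennreal_rat_dense[of "f x" "f x0"] ennreal_rat_dense[of "f x0" "f x"]
      by (auto dest: less_asym)
    then show ?case by simp
  qed
  then show ?thesis by blast
qed

text \<open>
  This is the identity \<open>\<parallel>C f\<parallel>\<^sup>2 = \<integral> h \<bar>f\<bar>\<^sup>2\<close>, i.e. \<open>C\<^sup>* C\<close> is multiplication by \<open>h\<close>.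
\<close>

lemma wcomp_nn_integral:
  assumes "sigma_finite_measure M" and [measurable]: "\<phi> \<in> measurable M M" "w \<in> borel_measurable M"
    and ac: "absolutely_continuous M (distr (weighted_measure M w) M \<phi>)"
    and [measurable]: "f \<in> borel_measurable M"
  shows "(\<integral>\<^sup>+x. ennreal ((cmod (wcomp \<phi> w f x))\<^sup>2) \<partial>M)
       = (\<integral>\<^sup>+x. wcomp_h M \<phi> w x * ennreal ((cmod (f x))\<^sup>2) \<partial>M)"
proof -
  interpret sigma_finite_measure M by fact
  have [measurable]: "\<phi> \<in> measurable (weighted_measure M w) M"
    by (simp add: weighted_measure_def)
  have "(\<integral>\<^sup>+x. ennreal ((cmod (wcomp \<phi> w f x))\<^sup>2) \<partial>M)
      = (\<integral>\<^sup>+x. ennreal ((cmod (f (\<phi> x)))\<^sup>2) \<partial>weighted_measure M w)"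
    by (simp add: weighted_measure_def nn_integral_density wcomp_def norm_mult power_mult_distrib ennreal_mult)
  also have "\<dots> = (\<integral>\<^sup>+x. ennreal ((cmod (f x))\<^sup>2) \<partial>distr (weighted_measure M w) M \<phi>)"
    by (simp add: nn_integral_distr)
  also have "\<dots> = (\<integral>\<^sup>+x. wcomp_h M \<phi> w x * ennreal ((cmod (f x))\<^sup>2) \<partial>M)"
    unfolding wcomp_h_def by (rule RN_deriv_nn_integral[OF ac]) simp_all
  finally show ?thesis .
qed

lemma L2_supported_closed_subspace:
  assumes A: "A \<in> sets M"
  shows "L2_closed_subspace M {f \<in> L2_fun M. AE x in M. x \<in> A \<longrightarrow> f x = 0}" (is "L2_closed_subspace M ?S")
  unfolding L2_closed_subspace_def
proof (intro conjI ballI allI impI)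
  show "(\<lambda>_. 0) \<in> ?S" by (simp add: L2_fun_def)
  fix f assume f: "f \<in> ?S"
  show "(\<lambda>x. c * f x) \<in> ?S" for c
    using f by (auto simp: L2_fun_scale)
  fix g assume g: "g \<in> ?S"
  have "AE x in M. x \<in> A \<longrightarrow> f x = 0" "AE x in M. x \<in> A \<longrightarrow> g x = 0" using f g by auto
  then have "AE x in M. x \<in> A \<longrightarrow> f x + g x = 0" by eventually_elim auto
  then show "(\<lambda>x. f x + g x) \<in> ?S" using f g by (simp add: L2_fun_add)
next
  fix f assume f: "f \<in> L2_fun M" and app: "\<forall>e>0. \<exists>g\<in>?S. L2_seminorm M (\<lambda>x. f x - g x) < e"
  define fA where "fA = (\<lambda>x. indicator A x * f x)"
  have meas: "f \<in> borel_measurable M" by (rule L2_fun_measurable[OF f])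
  have fA: "fA \<in> L2_fun M"
    by (rule L2_fun_bound[OF L2_fun_integrable[OF f]])
       (use A meas in \<open>auto simp: fA_def norm_mult indicator_def intro: measurable_compose\<close>)
  have "L2_seminorm M fA \<le> 0 + e" if e: "e > 0" for e
  proof -
    obtain g where g: "g \<in> L2_fun M" "AE x in M. x \<in> A \<longrightarrow> g x = 0"
      and fg: "L2_seminorm M (\<lambda>x. f x - g x) < e" using app e by blast
    have fgL: "(\<lambda>x. f x - g x) \<in> L2_fun M"
      using L2_fun_add[OF f L2_fun_scale[OF g(1), of "-1"]] by simp
    from g(2) have "AE x in M. ennreal ((cmod (fA x))\<^sup>2) \<le> ennreal ((cmod (f x - g x))\<^sup>2)"
      by eventually_elim (auto simp: fA_def indicator_def)
    then have "(\<integral>\<^sup>+x. ennreal ((cmod (fA x))\<^sup>2) \<partial>M) \<le> ennreal ((L2_seminorm M (\<lambda>x. f x - g x))\<^sup>2)"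
      unfolding L2_nn_integral[OF fgL, symmetric] by (rule nn_integral_mono_AE)
    then have "L2_seminorm M fA \<le> L2_seminorm M (\<lambda>x. f x - g x)"
      by (rule L2_seminorm_le(2)[OF L2_fun_measurable[OF fA] L2_seminorm_nonneg])
    then show ?thesis using fg by simp
  qed
  then have "L2_seminorm M fA \<le> 0" by (rule field_le_epsilon)
  then have "L2_seminorm M fA = 0" using L2_seminorm_nonneg[of M fA] by (rule antisym)
  then have "AE x in M. fA x = 0" using L2_seminorm_eq_0_iff[OF fA] by simp
  then have "AE x in M. x \<in> A \<longrightarrow> f x = 0" by eventually_elim (auto simp: fA_def)
  then show "f \<in> ?S" using f by simp
qed auto

text \<open>
  By \<open>\<sigma>\<close>-finiteness there is a strictly positive integrable function bounded by \<open>1\<close>, hence square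
  integrable. Its restriction to the complement of \<open>A\<close> is a nonzero vector of the subspace, and
  its restriction to \<open>A\<close> lies outside.
\<close>

lemma (in sigma_finite_measure) L2_supported_nontrivial:
  assumes A: "A \<in> sets M" and "\<not> (AE x in M. x \<notin> A)" "\<not> (AE x in M. x \<in> A)"
  shows "L2_nontrivial M {f \<in> L2_fun M. AE x in M. x \<in> A \<longrightarrow> f x = 0}"
proof -
  obtain u :: "'a \<Rightarrow> real" where u [measurable]: "u \<in> borel_measurable M" and "\<And>x. 0 < u x" "\<And>x. u x \<le> 1"
    "integrable M u" by (rule obtain_positive_integrable_function) blast
  define v where "v = (\<lambda>B x. complex_of_real (indicator B x * u x))"
  have v: "v B \<in> L2_fun M" if [measurable]: "B \<in> sets M" for B
  proof (rule L2_fun_bound[OF \<open>integrable M u\<close>])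
    fix x
    have "(u x)\<^sup>2 \<le> u x"
      using \<open>0 < u x\<close> \<open>u x \<le> 1\<close> by (simp add: power2_eq_square mult_left_le)
    then show "(cmod (v B x))\<^sup>2 \<le> u x"
      using \<open>0 < u x\<close> by (simp add: v_def indicator_def)
  qed (simp add: v_def)
  have v0: "v B x = 0 \<longleftrightarrow> x \<notin> B" for B x
    using \<open>0 < u x\<close> by (simp add: v_def indicator_def)
  have "v (space M - A) \<in> {f \<in> L2_fun M. AE x in M. x \<in> A \<longrightarrow> f x = 0}"
    using v A by (simp add: v0)
  moreover have "\<not> (AE x in M. v (space M - A) x = 0)"
    using assms(3) by (simp add: v0)
  moreover have "v A \<in> L2_fun M" "v A \<notin> {f \<in> L2_fun M. AE x in M. x \<in> A \<longrightarrow> f x = 0}"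
    using v A assms(2) by (auto simp: v0)
  ultimately show ?thesis unfolding L2_nontrivial_def by blast
qed

text \<open>
  If \<open>w x\<close> and \<open>f (\<phi> x)\<close> are both nonzero and \<open>f\<close> is supported on \<open>{c \<le> h}\<close>, then \<open>c \<le> h (\<phi> x) \<le> h x\<close>.
  Absolute continuity is what pulls the condition on the support, which \<open>f\<close> satisfies only almost
  everywhere, back along \<open>\<phi>\<close>.
\<close>

lemma wcomp_superlevel_invariant:
  assumes [measurable]: "\<phi> \<in> measurable M M" "w \<in> borel_measurable M"
    and ac: "absolutely_continuous M (distr (weighted_measure M w) M \<phi>)"
    and dom: "wcomp_domain M \<phi> w = L2_fun M"
    and incr: "AE x in weighted_measure M w. wcomp_h M \<phi> w (\<phi> x) \<le> wcomp_h M \<phi> w x"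
    and f: "f \<in> L2_fun M" "AE x in M. wcomp_h M \<phi> w x < c \<longrightarrow> f x = 0"
  shows "wcomp \<phi> w f \<in> L2_fun M" "AE x in M. wcomp_h M \<phi> w x < c \<longrightarrow> wcomp \<phi> w f x = 0"
proof -
  show "wcomp \<phi> w f \<in> L2_fun M"
    using f(1) dom by (auto simp: wcomp_domain_def)
  have [measurable]: "\<phi> \<in> measurable (weighted_measure M w) M"
    by (simp add: weighted_measure_def)
  have "AE y in distr (weighted_measure M w) M \<phi>. wcomp_h M \<phi> w y < c \<longrightarrow> f y = 0"
    by (rule absolutely_continuous_AE[OF _ ac f(2)]) simp
  then have "AE x in weighted_measure M w. wcomp_h M \<phi> w (\<phi> x) < c \<longrightarrow> f (\<phi> x) = 0"
    by (rule AE_distrD[rotated]) measurable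
  with incr have "AE x in weighted_measure M w. wcomp_h M \<phi> w x < c \<longrightarrow> f (\<phi> x) = 0"
    by eventually_elim (auto intro: le_less_trans)
  moreover have "(\<lambda>x. ennreal ((cmod (w x))\<^sup>2)) \<in> borel_measurable M" by measurable
  ultimately have "AE x in M. 0 < ennreal ((cmod (w x))\<^sup>2) \<longrightarrow> wcomp_h M \<phi> w x < c \<longrightarrow> f (\<phi> x) = 0"
    unfolding weighted_measure_def by (simp only: AE_density)
  then show "AE x in M. wcomp_h M \<phi> w x < c \<longrightarrow> wcomp \<phi> w f x = 0"
    by eventually_elim (auto simp: wcomp_def)
qed

lemma wcomp_h_measurable: "wcomp_h M \<phi> w \<in> borel_measurable M"
  unfolding wcomp_h_def by simp

theorem proposition22:
  fixes M :: "'a measure" and \<phi> :: "'a \<Rightarrow> 'a" and w :: "'a \<Rightarrow> complex"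
  assumes "sigma_finite_measure M"
    and "\<phi> \<in> measurable M M"
    and "w \<in> borel_measurable M"
    and "absolutely_continuous M (distr (weighted_measure M w) M \<phi>)"
    and "\<exists>f\<in>L2_fun M. \<exists>g\<in>L2_fun M. L2_linearly_independent M f g"
    and "wcomp_domain M \<phi> w = L2_fun M"
    and "wcomp_bounded M \<phi> w"
    and "AE x in weighted_measure M w. wcomp_cond_exp M \<phi> w (wcomp_h M \<phi> w) x = wcomp_h M \<phi> w x"
    and "AE x in weighted_measure M w. wcomp_h M \<phi> w (\<phi> x) \<le> wcomp_h M \<phi> w x"
  shows "L2_has_nontrivial_invariant_subspace M (wcomp \<phi> w)"
proof -
  define h where "h = wcomp_h M \<phi> w"
  define T where "T = wcomp \<phi> w"
  have h [measurable]: "h \<in> borel_measurable M" unfolding h_def by (rule wcomp_h_measurable)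
  have T_L2: "T f \<in> L2_fun M" if "f \<in> L2_fun M" for f
    using that assms(6) by (auto simp: T_def wcomp_domain_def)
  show ?thesis
  proof (cases "\<exists>c. \<not> (AE x in M. h x < c) \<and> \<not> (AE x in M. c \<le> h x)")
    case True
    then obtain c where c: "\<not> (AE x in M. h x < c)" "\<not> (AE x in M. c \<le> h x)" by blast
    \<comment> \<open>Both \<open>{h < c}\<close> and \<open>{c \<le> h}\<close> have positive measure.\<close>
    define A where "A = {x \<in> space M. h x < c}"
    have A: "A \<in> sets M" unfolding A_def by measurable
    have inA: "(AE x in M. x \<in> A \<longrightarrow> P x) \<longleftrightarrow> (AE x in M. h x < c \<longrightarrow> P x)" for P
      by (rule AE_cong) (simp add: A_def)
    let ?S = "{f \<in> L2_fun M. AE x in M. x \<in> A \<longrightarrow> f x = 0}"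
    have "T ` ?S \<subseteq> ?S"
      unfolding inA T_def h_def using wcomp_superlevel_invariant[OF assms(2-4,6,9)] by blast
    moreover have "\<not> (AE x in M. x \<notin> A)"
      using c(2) inA[of "\<lambda>_. False"] by (simp add: not_less)
    moreover have "\<not> (AE x in M. x \<in> A)"
    proof
      assume "AE x in M. x \<in> A"
      then have "AE x in M. h x < c" by eventually_elim (simp add: A_def)
      with c(1) show False ..
    qed
    ultimately show ?thesis
      using L2_supported_closed_subspace[OF A]
        sigma_finite_measure.L2_supported_nontrivial[OF assms(1) A]
      unfolding L2_has_nontrivial_invariant_subspace_def T_def by blast
  next
    case False
    then obtain k where k: "AE x in M. h x = k"
      using AE_const_if_AE_dichotomy[of h M] by blast
    interpret semi_hilbert fun_scale "L2_fun M" "L2_ip M" by (rule L2_semi_hilbert)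
    obtain f g where fg: "f \<in> L2_fun M" "g \<in> L2_fun M" "L2_linearly_independent M f g"
      using assms(5) by blast
    have indep: "a = 0 \<and> b = 0" if "nrm (fun_scale a f + fun_scale b g) = 0" for a b
    proof -
      have "(\<lambda>x. a * f x + b * g x) \<in> L2_fun M"
        using fg by (intro L2_fun_add L2_fun_scale)
      then show ?thesis
        using that fg(3) L2_seminorm_eq_0_iff
        unfolding L2_linearly_independent_def L2_nrm plus_fun_def by blast
    qed
    have scaling: "ennreal ((nrm (T u))\<^sup>2) = k * ennreal ((nrm u)\<^sup>2)" if u: "u \<in> L2_fun M" for u
    proof -
      have [measurable]: "u \<in> borel_measurable M" by (rule L2_fun_measurable[OF u])
      have "ennreal ((nrm (T u))\<^sup>2) = (\<integral>\<^sup>+x. h x * ennreal ((cmod (u x))\<^sup>2) \<partial>M)"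
        using wcomp_nn_integral[OF assms(1-4)] L2_nn_integral[OF T_L2[OF u]]
        by (simp add: L2_nrm T_def h_def)
      also have "\<dots> = (\<integral>\<^sup>+x. k * ennreal ((cmod (u x))\<^sup>2) \<partial>M)"
        using k by (intro nn_integral_cong_AE) auto
      also have "\<dots> = k * ennreal ((nrm u)\<^sup>2)"
        by (simp add: nn_integral_cmult L2_nn_integral[OF u] L2_nrm)
      finally show ?thesis .
    qed
    have "nrm f \<noteq> 0" using indep[of 1 0] by (auto simp: zero_fun_def plus_fun_def)
    have "k \<noteq> \<infinity>"
    proof
      assume "k = \<infinity>"
      with scaling[OF fg(1)] \<open>nrm f \<noteq> 0\<close> show False
        by (simp add: ennreal_top_mult ennreal_eq_0_iff)
    qed
    then obtain r where r: "0 \<le> r" "k = ennreal r"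
      by (metis ennreal_cases infinity_ennreal_def)
    have nrm_T: "nrm (T u) = sqrt r * nrm u" if u: "u \<in> L2_fun M" for u
    proof -
      have "ennreal ((nrm (T u))\<^sup>2) = ennreal (r * (nrm u)\<^sup>2)"
        using scaling[OF u] r by (simp add: ennreal_mult)
      then have "(nrm (T u))\<^sup>2 = (sqrt r * nrm u)\<^sup>2"
        using r(1) by (simp add: power_mult_distrib)
      then show ?thesis
        using r(1) u T_L2[OF u] by (simp add: power2_eq_iff_nonneg)
    qed
    have linear_T: "linear_op T"
      unfolding linear_op_iff by (auto simp: T_def wcomp_def fun_eq_iff algebra_simps)
    have T_bounded: "bounded_op (sqrt r) T"
      using linear_T T_L2 nrm_T by (simp add: bounded_op_def)
    have "\<exists>S. nontrivial_invariant T S"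
    proof (cases "r = 0")
      case True
      then have "nrm (T u - fun_scale 0 u) = 0" if "u \<in> L2_fun M" for u
        using nrm_T[OF that] by (simp add: fun_diff_def)
      from scalar_nontrivial_invariant[of T 0 f g, OF T_L2 this fg(1,2) indep] show ?thesis by blast
    next
      case False
      define c where "c = complex_of_real (1 / sqrt r)"
      have "isometric_op (\<lambda>u. fun_scale c (T u))"
        unfolding isometric_op_def
      proof (intro conjI ballI)
        show "linear_op (\<lambda>u. fun_scale c (T u))"
          by (rule bounded_op_linear[OF bounded_op_scale[OF T_bounded]])
        fix u assume u: "u \<in> L2_fun M"
        show "fun_scale c (T u) \<in> L2_fun M" by (rule L2_fun_scale[OF T_L2[OF u]])
        show "nrm (fun_scale c (T u)) = nrm u"
          using nrm_scale[OF T_L2[OF u], of c] nrm_T[OF u] r(1) False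
          by (simp add: c_def norm_divide)
      qed
      from isometric_op_has_nontrivial_invariant[OF this fg(1,2) indep]
      obtain S where "nontrivial_invariant (\<lambda>u. fun_scale c (T u)) S" by blast
      moreover have "c \<noteq> 0" using r(1) False by (simp add: c_def)
      ultimately show ?thesis using nontrivial_invariant_unscale[of c T S] by blast
    qed
    then show ?thesis
      using L2_invariant_subspace_if_nontrivial_invariant unfolding T_def by blast
  qed
qed

end
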